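(* Let $r\ge1$ be an integer and let $S:\mathbb{R}^{r+1}\to\mathbb{R}$ be a local potential satisfying conditions A, B and C, with Peierls barrier $P_\omega(\xi)$. The map $\omega\mapsto P_\omega(\xi)$ is continuous at every irrational $\omega$, uniformly in $\xi$: for every $\omega\in\mathbb{R}\setminus\mathbb{Q}$ and $\varepsilon>0$ there is $\delta>0$ such that $|P_\omega(\xi)-P_\Omega(\xi)|<\varepsilon$ for all $\Omega\in\mathbb{R}$ with $|\Omega-\omega|<\delta$ and all $\xi\in\mathbb{R}$.
   Context: Conditions on $S:\mathbb{R}^{r+1}\to\mathbb{R}$, written as $S(x_0,\dots,x_r)$: A (periodicity): $S(x_0+1,\dots,x_r+1)=S(x_0,\dots,x_r)$ for all arguments. B (monotonicity): $S$ is $C^2$, $\partial_i\partial_k S\le 0$ everywhere for all $i\ne k$, and $\partial_0\partial_1 S<0$ everywhere. C (coercivity): $S$ is bounded from below and there is $k\in\{0,\dots,r-1\}$ such that $S(x_0,\dots,x_r)\to\infty$ as $|x_{k+1}-x_k|\to\infty$. For $p,q\in\mathbb{Z}$ with $p\ge1$ let $\mathbb{X}_{p,q}$ be the set of sequences $x:\mathbb{Z}\to\mathbb{R}$ with $x_{i-p}+q=x_i$ for all $i$, and for $x\in\mathbb{X}_{p,q}$ let $W_{p,q}(x)=\sum_{j=0}^{p-1}S(x_j,\dots,x_{j+r})$. For a rational $q/p$ in lowest terms (with $p\ge1$) and $\xi\in\mathbb{R}$, the Peierls barrier is $$P_{q/p}(\xi)=\min_{x\in\mathbb{X}_{p,q},\,x_0=\xi}W_{p,q}(x)-\min_{x\in\mathbb{X}_{p,q}}W_{p,q}(x).$$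 For irrational $\omega$, $P_\omega(\xi)=\lim_{q/p\to\omega}P_{q/p}(\xi)$, the limit being over rationals converging to $\omega$ (this limit exists). *)

theory Defs
  imports "HOL-Analysis.Analysis"
begin

text \<open>
  A potential \<open>S(x\<^sub>0, \<dots>, x\<^sub>r)\<close> on \<open>\<real>\<^bsup>r+1\<^esup>\<close> is a function on \<open>real ^ 'n\<close> where \<open>'n\<close> is a finite
  linearly ordered index type with \<open>CARD('n) = r + 1\<close>. The coordinate written \<open>x\<^sub>k\<close> is the one
  whose index has exactly \<open>k\<close> predecessors. Every \<open>r\<close> is covered, since every positive
  cardinality is that of some finite linearly ordered type.
\<close>

definition pos :: "'n::{finite,linorder} \<Rightarrow> nat" where
  "pos i = card {..<i}"

lemma strict_mono_pos: "strict_mono (pos :: 'n::{finite,linorder} \<Rightarrow> nat)"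
  unfolding strict_mono_def pos_def
  by (auto intro!: psubset_card_mono)

lemma bij_betw_pos: "bij_betw (pos :: 'n::{finite,linorder} \<Rightarrow> nat) UNIV {..<CARD('n)}"
proof -
  have inj: "inj (pos :: 'n \<Rightarrow> nat)"
    using strict_mono_pos by (rule strict_mono_imp_inj_on)
  have "range (pos :: 'n \<Rightarrow> nat) \<subseteq> {..<CARD('n)}"
    by (auto simp: pos_def intro!: psubset_card_mono)
  then have "range (pos :: 'n \<Rightarrow> nat) = {..<CARD('n)}"
    by (rule card_subset_eq[rotated]) (simp_all add: card_image[OF inj])
  with inj show ?thesis by (simp add: bij_betw_def)
qed

definition partial_deriv :: "'n::finite \<Rightarrow> (real ^ 'n \<Rightarrow> real) \<Rightarrow> real ^ 'n \<Rightarrow> real" where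
  "partial_deriv i f x = deriv (\<lambda>t. f (x + t *\<^sub>R axis i 1)) 0"

definition C2 :: "('a::real_normed_vector \<Rightarrow> real) \<Rightarrow> bool" where
  "C2 f \<longleftrightarrow> (\<exists>(f' :: 'a \<Rightarrow> 'a \<Rightarrow>\<^sub>L real) (f'' :: 'a \<Rightarrow> 'a \<Rightarrow>\<^sub>L 'a \<Rightarrow>\<^sub>L real).
     (\<forall>x. (f has_derivative blinfun_apply (f' x)) (at x)) \<and>
     (\<forall>x. (f' has_derivative blinfun_apply (f'' x)) (at x)) \<and>
     continuous_on UNIV f'')"

definition periodicity :: "(real ^ 'n::finite \<Rightarrow> real) \<Rightarrow> bool" where
  "periodicity S \<longleftrightarrow> (\<forall>x. S (\<chi> i. x $ i + 1) = S x)"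

definition monotonicity :: "(real ^ 'n::{finite,linorder} \<Rightarrow> real) \<Rightarrow> bool" where
  "monotonicity S \<longleftrightarrow> C2 S \<and>
     (\<forall>i k x. i \<noteq> k \<longrightarrow> partial_deriv i (partial_deriv k S) x \<le> 0) \<and>
     (\<forall>i k x. pos i = 0 \<longrightarrow> pos k = 1 \<longrightarrow> partial_deriv i (partial_deriv k S) x < 0)"

definition coercivity :: "(real ^ 'n::{finite,linorder} \<Rightarrow> real) \<Rightarrow> bool" where
  "coercivity S \<longleftrightarrow> bdd_below (range S) \<and>
     (\<exists>i i'. pos i' = pos i + 1 \<and>
        filterlim S at_top (filtercomap (\<lambda>x. \<bar>x $ i' - x $ i\<bar>) at_top))"

definition periodic_seqs :: "int \<Rightarrow> int \<Rightarrow> (int \<Rightarrow> real) set" where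
  "periodic_seqs p q = {x. \<forall>i. x (i - p) + of_int q = x i}"

definition action :: "(real ^ 'n::{finite,linorder} \<Rightarrow> real) \<Rightarrow> int \<Rightarrow> (int \<Rightarrow> real) \<Rightarrow> real" where
  "action S p x = (\<Sum>j\<in>{0..<p}. S (\<chi> i. x (j + int (pos i))))"

text \<open>The minima are rendered by \<open>LEAST\<close>, i.e. as least elements of the sets of values, not as infima.\<close>

definition peierls_rat :: "(real ^ 'n::{finite,linorder} \<Rightarrow> real) \<Rightarrow> rat \<Rightarrow> real \<Rightarrow> real" where
  "peierls_rat S \<rho> \<xi> = (case quotient_of \<rho> of (q, p) \<Rightarrow>
     (LEAST w. w \<in> action S p ` {x \<in> periodic_seqs p q. x 0 = \<xi>}) -
     (LEAST w. w \<in> action S p ` periodic_seqs p q))"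

definition peierls :: "(real ^ 'n::{finite,linorder} \<Rightarrow> real) \<Rightarrow> real \<Rightarrow> real \<Rightarrow> real" where
  "peierls S \<omega> \<xi> =
     (if \<omega> \<in> \<rat> then peierls_rat S (THE \<rho>. of_rat \<rho> = \<omega>) \<xi>
      else Lim (filtercomap real_of_rat (nhds \<omega>)) (\<lambda>\<rho>. peierls_rat S \<rho> \<xi>))"

end

theory Submission
  imports Defs "HOL-Complex_Analysis.Great_Picard" "HOL-Analysis.Kronecker_Approximation_Theorem"
begin

text \<open>
  By monotonicity, exchanging two sequences for their pointwise minimum and maximum never increases
  the action, and strictly decreases it where they cross. Hence periodic minimisers do not cross
  their translates, and their limits with irrational rotation number \<open>\<omega>\<close> are still action minimising
  on finite pieces. Two such limits that are recurrent along common translations cannot cross either: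
  the gain of a crossing would recur infinitely often and outweigh the bounded cost of cutting and
  pasting. So if \<open>q/p\<close> and \<open>Q/P\<close> are close to \<open>\<omega>\<close>, the minimisers near \<open>\<xi>\<close> for both rotation numbers lie
  in a common band between two translates, which is thin on suitable windows on both sides of the site \<open>0\<close>.
  Transplanting the constrained minimiser for \<open>q/p\<close> between two such windows into the minimiser for
  \<open>Q/P\<close> shows that the Peierls barriers at \<open>\<xi>\<close> are close, uniformly in \<open>\<xi>\<close>.
\<close>

section \<open>Local potentials\<close>

text \<open>The band between a sequence and a nearby translate need not be uniformly thin, since the
  limiting minimisers may leave gaps of fixed size. What is small is its width averaged over long
  stretches, because the differences telescope; this is why closeness can be asked only on windows
  that a counting argument finds. A limit of periodic minimisers is not known to be recurrent, while
  the crossing argument needs recurrence. Such a limit is therefore replaced by the infimum of its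
  translates of positive height, at the cost of one translate on either side. Since touching
  propagates to the left only, recurrence is always taken along shifts tending to minus infinity.
  Uniformity in \<open>\<xi>\<close> comes from a compactness argument by contradiction,
  \<open>\<xi>\<close> being reduced to [0, 1] by integer translations. The comparison is made
  between rational barriers only: it yields a uniform Cauchy property, hence both the existence of
  the limit behind \<open>peierls\<close> at irrational numbers and its continuity there.\<close>

definition window :: "(int \<Rightarrow> real) \<Rightarrow> int \<Rightarrow> real ^ 'n::{finite,linorder}" where
  "window x j = (\<chi> i. x (j + int (pos i)))"

lemma window_nth [simp]: "window x j $ i = x (j + int (pos i))"
  by (simp add: window_def)

text \<open>The outer partial derivative is the first slot of the bilinear form. The order of the
  slots matters, as strict negativity is assumed for one order.\<close>

lemma partial_deriv_partial_deriv:
  fixes S :: "real ^ 'n::finite \<Rightarrow> real"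
  assumes S': "\<And>x. (S has_derivative blinfun_apply (S' x)) (at x)"
    and S'': "\<And>x. (S' has_derivative blinfun_apply (S'' x)) (at x)"
  shows "partial_deriv i (partial_deriv k S) x = S'' x (axis i 1) (axis k 1)"
proof -
  have line: "((\<lambda>t. x + t *\<^sub>R axis i 1) has_derivative (\<lambda>t. t *\<^sub>R axis i 1)) (at 0)"
    for i and x :: "real ^ 'n"
    by (auto intro!: derivative_eq_intros)
  have *: "partial_deriv k S x = S' x (axis k 1)" for k x
  proof -
    have "((\<lambda>t. S (x + t *\<^sub>R axis k 1)) has_derivative (\<lambda>t. S' x (t *\<^sub>R axis k 1))) (at 0)"
      using has_derivative_compose[OF line, of S "S' x"] S'[of x] by simp
    then have "((\<lambda>t. S (x + t *\<^sub>R axis k 1)) has_field_derivative S' x (axis k 1)) (at 0)"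
      by (simp add: has_field_derivative_def blinfun.scaleR_right mult_commute_abs)
    then show ?thesis unfolding partial_deriv_def by (rule DERIV_imp_deriv)
  qed
  have "((\<lambda>t. S' (x + t *\<^sub>R axis i 1)) has_derivative (\<lambda>t. S'' x (t *\<^sub>R axis i 1))) (at 0)"
    using has_derivative_compose[OF line, of S' "S'' x"] S''[of x] by simp
  then have "((\<lambda>t. S' (x + t *\<^sub>R axis i 1) (axis k 1)) has_derivative
      (\<lambda>t. S'' x (t *\<^sub>R axis i 1) (axis k 1))) (at 0)"
    by (auto intro!: derivative_eq_intros)
  then have "((\<lambda>t. S' (x + t *\<^sub>R axis i 1) (axis k 1)) has_field_derivative S'' x (axis i 1) (axis k 1)) (at 0)"
    by (simp add: has_field_derivative_def blinfun.scaleR_right blinfun.scaleR_left mult_commute_abs)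
  then show ?thesis
    unfolding partial_deriv_def[of i] * by (rule DERIV_imp_deriv)
qed

section \<open>Submodularity of the potential and strong comparison\<close>

locale local_potential =
  fixes S :: "real ^ 'n::{finite,linorder} \<Rightarrow> real" and r :: nat
  assumes r_pos: "r \<ge> 1" and card_r: "CARD('n) = r + 1"
    and per: "periodicity S" and mono: "monotonicity S" and coer: "coercivity S"
begin

definition idx :: "nat \<Rightarrow> 'n" where
  "idx = inv_into UNIV pos"

lemma pos_le_r: "pos (i :: 'n) \<le> r"
  using bij_betw_apply[OF bij_betw_pos, of i] card_r by simp

lemma pos_idx: "k \<le> r \<Longrightarrow> pos (idx k) = k"
  unfolding idx_def using bij_betw_imp_surj_on[OF bij_betw_pos[where 'n='n]] card_r
  by (intro f_inv_into_f) simp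

lemma pos_eq_iff: "pos (i :: 'n) = pos k \<longleftrightarrow> i = k"
  using bij_betw_pos[where 'n='n] by (auto simp: bij_betw_def inj_def)

lemma idx_pos: "idx (pos i) = i"
  using pos_idx[OF pos_le_r] pos_eq_iff by blast

definition dS :: "(real, 'n) vec \<Rightarrow> (real, 'n) vec \<Rightarrow>\<^sub>L real" where
  "dS = (SOME S'. (\<forall>x. (S has_derivative blinfun_apply (S' x)) (at x)) \<and>
     (\<exists>S''. \<forall>x. (S' has_derivative blinfun_apply (S'' x)) (at x)))"

definition ddS :: "(real, 'n) vec \<Rightarrow> (real, 'n) vec \<Rightarrow>\<^sub>L (real, 'n) vec \<Rightarrow>\<^sub>L real" where
  "ddS = (SOME S''. \<forall>x. (dS has_derivative blinfun_apply (S'' x)) (at x))"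

lemma dS: "(S has_derivative blinfun_apply (dS x)) (at x)"
  and ddS: "(dS has_derivative blinfun_apply (ddS x)) (at x)"
proof -
  have "\<exists>S'. (\<forall>x. (S has_derivative blinfun_apply (S' x)) (at x)) \<and>
     (\<exists>S''. \<forall>x. (S' has_derivative blinfun_apply (S'' x)) (at x))"
    using mono unfolding monotonicity_def C2_def by blast
  from someI_ex[OF this] have *: "\<forall>x. (S has_derivative blinfun_apply (dS x)) (at x)"
    "\<exists>S''. \<forall>x. (dS has_derivative blinfun_apply (S'' x)) (at x)"
    unfolding dS_def by blast+
  from * show "(S has_derivative blinfun_apply (dS x)) (at x)" by blast
  show "(dS has_derivative blinfun_apply (ddS x)) (at x)"
    using someI_ex[OF *(2)] unfolding ddS_def by blast
qed

lemma ddS_nonpos: "i \<noteq> k \<Longrightarrow> ddS x (axis i 1) (axis k 1) \<le> 0"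
  and ddS_neg: "pos i = 0 \<Longrightarrow> pos k = 1 \<Longrightarrow> ddS x (axis i 1) (axis k 1) < 0"
proof -
  have *: "partial_deriv i (partial_deriv k S) x = ddS x (axis i 1) (axis k 1)" for i k x
    by (rule partial_deriv_partial_deriv) (rule dS ddS)+
  have 1: "\<forall>i k x. i \<noteq> k \<longrightarrow> ddS x (axis i 1) (axis k 1) \<le> 0"
    and 2: "\<forall>i k x. pos i = 0 \<longrightarrow> pos k = 1 \<longrightarrow> ddS x (axis i 1) (axis k 1) < 0"
    using mono unfolding monotonicity_def * by simp_all
  from 1 show "ddS x (axis i 1) (axis k 1) \<le> 0" if "i \<noteq> k"
    using that by simp
  from 2 show "ddS x (axis i 1) (axis k 1) < 0" if "pos i = 0" "pos k = 1"
    using that by simp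
qed

lemma continuous_S: "continuous_on A S"
  using dS by (meson continuous_at_imp_continuous_on has_derivative_continuous)

lemma vec_expand: "(v :: (real, 'n) vec) = (\<Sum>i\<in>UNIV. v $ i *\<^sub>R axis i 1)"
  using basis_expansion[of v] by (simp add: scalar_mult_eq_scaleR)

lemma ddS_expand: "ddS z v u = (\<Sum>i\<in>UNIV. \<Sum>k\<in>UNIV. v $ i * u $ k * ddS z (axis i 1) (axis k 1))"
proof -
  have "ddS z v u = (\<Sum>i\<in>UNIV. v $ i * ddS z (axis i 1) u)"
    by (subst vec_expand[of v]) (simp add: blinfun.sum_right blinfun.sum_left
        blinfun.scaleR_right blinfun.scaleR_left)
  moreover have "ddS z (axis i 1) u = (\<Sum>k\<in>UNIV. u $ k * ddS z (axis i 1) (axis k 1))" for i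
    by (subst vec_expand[of u]) (simp add: blinfun.sum_right blinfun.scaleR_right)
  ultimately show ?thesis
    by (simp add: sum_distrib_left mult.assoc)
qed

text \<open>In the expansion over pairs of coordinates the diagonal terms vanish by disjointness,
  and the mixed derivatives are nonpositive. Strictness comes from the pair of coordinates 0 and
  1.\<close>

lemma ddS_disjoint:
  assumes u: "\<And>i. u $ i \<ge> 0" and v: "\<And>i. v $ i \<ge> 0" and disj: "\<And>i. u $ i * v $ i = 0"
  shows "ddS z v u \<le> 0"
    and "v $ idx 0 * u $ idx 1 > 0 \<Longrightarrow> ddS z v u < 0"
proof -
  have le: "v $ i * u $ k * ddS z (axis i 1) (axis k 1) \<le> 0" for i k
    using u[of k] v[of i] disj[of i] ddS_nonpos[of i k z]
    by (cases "i = k") (auto simp: mult_nonneg_nonpos mult.commute)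
  show "ddS z v u \<le> 0"
    by (subst ddS_expand) (rule sum_nonpos, rule sum_nonpos, rule le)
  assume *: "v $ idx 0 * u $ idx 1 > 0"
  have "(\<Sum>i\<in>UNIV. \<Sum>k\<in>UNIV. v $ i * u $ k * ddS z (axis i 1) (axis k 1))
      < (\<Sum>i\<in>(UNIV::'n set). 0)"
  proof (rule sum_strict_mono_ex1)
    have "(\<Sum>k\<in>UNIV. v $ (idx 0) * u $ k * ddS z (axis (idx 0) 1) (axis k 1)) < (\<Sum>k\<in>(UNIV::'n set). 0)"
    proof (rule sum_strict_mono_ex1)
      show "\<exists>k\<in>UNIV. v $ (idx 0) * u $ k * ddS z (axis (idx 0) 1) (axis k 1) < 0"
        using mult_pos_neg[OF * ddS_neg[of "idx 0" "idx 1" z]] pos_idx[of 0] pos_idx[of 1] r_pos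
        by (intro bexI[of _ "idx 1"]) auto
    qed (simp_all add: le)
    then show "\<exists>i\<in>UNIV. (\<Sum>k\<in>UNIV. v $ i * u $ k * ddS z (axis i 1) (axis k 1)) < 0"
      by auto
  qed (simp_all add: le sum_nonpos)
  then show "ddS z v u < 0" by (subst ddS_expand) simp
qed

lemma dS_diff: "\<exists>z. dS (x + v) u - dS x u = ddS z v u"
proof -
  have "((\<lambda>t. dS (x + t *\<^sub>R v) u) has_derivative (\<lambda>h. ddS (x + t *\<^sub>R v) (h *\<^sub>R v) u)) (at t)" for t :: real
  proof -
    have "((\<lambda>t. x + t *\<^sub>R v) has_derivative (\<lambda>t. t *\<^sub>R v)) (at t)"
      by (auto intro!: derivative_eq_intros)
    from has_derivative_compose[OF this ddS]
    have "((\<lambda>t. dS (x + t *\<^sub>R v)) has_derivative (\<lambda>h. ddS (x + t *\<^sub>R v) (h *\<^sub>R v))) (at t)" .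
    then show ?thesis by (auto intro!: derivative_eq_intros)
  qed
  then have d: "((\<lambda>t. dS (x + t *\<^sub>R v) u) has_field_derivative ddS (x + t *\<^sub>R v) v u) (at t)" for t
    by (simp add: has_field_derivative_def blinfun.scaleR_right blinfun.scaleR_left
        mult_commute_abs)
  have "\<exists>t>0. t < 1 \<and> dS (x + 1 *\<^sub>R v) u - dS (x + 0 *\<^sub>R v) u = (1 - 0) * ddS (x + t *\<^sub>R v) v u"
    by (rule MVT2[OF zero_less_one]) (rule d)
  then show ?thesis by auto
qed

text \<open>The mean value theorem along \<open>u\<close> and then along \<open>v\<close> turns the
  second difference into \<open>ddS z v u\<close>. This is submodularity of
  \<open>S\<close>.\<close>

lemma second_difference:
  assumes u: "\<And>i. u $ i \<ge> 0" and v: "\<And>i. v $ i \<ge> 0" and disj: "\<And>i. u $ i * v $ i = 0"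
  shows "S (m + u + v) + S m \<le> S (m + u) + S (m + v)"
    and "v $ idx 0 * u $ idx 1 > 0 \<Longrightarrow> S (m + u + v) + S m < S (m + u) + S (m + v)"
proof -
  have dl: "((\<lambda>s. S (w + s *\<^sub>R u)) has_field_derivative dS (w + s *\<^sub>R u) u) (at s)" for w s
  proof -
    have "((\<lambda>t. w + t *\<^sub>R u) has_derivative (\<lambda>t. t *\<^sub>R u)) (at s)"
      by (auto intro!: derivative_eq_intros)
    from has_derivative_compose[OF this dS] show ?thesis
      by (simp add: has_field_derivative_def blinfun.scaleR_right mult_commute_abs)
  qed
  have d: "((\<lambda>s. S (m + v + s *\<^sub>R u) - S (m + s *\<^sub>R u)) has_field_derivative
      (dS (m + v + s *\<^sub>R u) u - dS (m + s *\<^sub>R u) u)) (at s)" for s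
    by (intro DERIV_diff dl)
  have "\<exists>s>0. s < 1 \<and> S (m + v + 1 *\<^sub>R u) - S (m + 1 *\<^sub>R u) - (S (m + v + 0 *\<^sub>R u) - S (m + 0 *\<^sub>R u)) =
      (1 - 0) * (dS (m + v + s *\<^sub>R u) u - dS (m + s *\<^sub>R u) u)"
    by (rule MVT2[OF zero_less_one]) (rule d)
  then obtain s where s:
    "S (m + v + u) - S (m + u) - (S (m + v) - S m) = dS (m + v + s *\<^sub>R u) u - dS (m + s *\<^sub>R u) u"
    by auto
  obtain z where z: "dS (m + s *\<^sub>R u + v) u - dS (m + s *\<^sub>R u) u = ddS z v u"
    using dS_diff by blast
  have eq: "S (m + u + v) - S (m + u) - (S (m + v) - S m) = ddS z v u"
    using s z by (simp add: add_ac)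
  show "S (m + u + v) + S m \<le> S (m + u) + S (m + v)"
    using eq ddS_disjoint(1)[OF assms, of z] by linarith
  show "S (m + u + v) + S m < S (m + u) + S (m + v)" if "v $ idx 0 * u $ idx 1 > 0"
    using eq ddS_disjoint(2)[OF assms, of z] that by linarith
qed

definition loc :: "(int \<Rightarrow> real) \<Rightarrow> int \<Rightarrow> real" where
  "loc x j = S (window x j)"

lemma action_eq: "action S p x = (\<Sum>j\<in>{0..<p}. loc x j)"
  by (simp add: action_def loc_def window_def)

lemma loc_cong: "(\<And>i. j \<le> i \<Longrightarrow> i \<le> j + int r \<Longrightarrow> x i = y i) \<Longrightarrow> loc x j = loc y j"
  using pos_le_r unfolding loc_def window_def by (intro arg_cong[of _ _ S]) (auto simp: vec_eq_iff)

lemma loc_shift: "loc (\<lambda>i. x (i + k)) j = loc x (j + k)"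
  unfolding loc_def window_def by (intro arg_cong[of _ _ S]) (auto simp: vec_eq_iff algebra_simps)

lemma S_add_int: "S (\<chi> i. x $ i + of_int l) = S x"
proof -
  have 1: "S (\<chi> i. x $ i + 1) = S x" for x
    using per unfolding periodicity_def by blast
  have nat: "S (\<chi> i. x $ i + of_nat l) = S x" for l x
  proof (induction l)
    case (Suc l)
    then show ?case using 1[of "\<chi> i. x $ i + of_nat l"] by (simp add: algebra_simps)
  qed simp
  show ?thesis
  proof (cases l)
    case (nonneg n)
    then show ?thesis using nat by simp
  next
    case (neg n)
    then show ?thesis using nat[of "\<chi> i. x $ i + of_int l" "Suc n"] by simp
  qed
qed

lemma loc_add_int: "loc (\<lambda>i. x i + of_int l) j = loc x j"
  using S_add_int[of "window x j" l] unfolding loc_def window_def by simp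

text \<open>The excesses \<open>u\<close> and \<open>v\<close> of \<open>x\<close> and
  \<open>y\<close> over their minimum \<open>m\<close> have disjoint supports, and the maximum is
  \<open>m + u + v\<close>. A sign change between \<open>j\<close> and \<open>j + 1\<close> puts one
  excess at coordinate 0 and the other at coordinate 1.\<close>

lemma loc_crossing:
  "loc (\<lambda>i. min (x i) (y i)) j + loc (\<lambda>i. max (x i) (y i)) j \<le> loc x j + loc y j"
  "(x j - y j) * (x (j + 1) - y (j + 1)) < 0 \<Longrightarrow>
   loc (\<lambda>i. min (x i) (y i)) j + loc (\<lambda>i. max (x i) (y i)) j < loc x j + loc y j"
proof -
  define m :: "(real, 'n) vec" where "m = window (\<lambda>i. min (x i) (y i)) j"
  define u where "u = window x j - m"
  define v where "v = window y j - m"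
  have M: "window (\<lambda>i. max (x i) (y i)) j = m + u + v" "m + v + u = m + u + v"
    by (auto simp: vec_eq_iff m_def u_def v_def)
  have uv: "u $ i \<ge> 0" "v $ i \<ge> 0" "u $ i * v $ i = 0" "v $ i * u $ i = 0" for i
    by (auto simp: m_def u_def v_def min_def)
  have xy: "window x j = m + u" "window y j = m + v"
    by (auto simp: u_def v_def)
  show "loc (\<lambda>i. min (x i) (y i)) j + loc (\<lambda>i. max (x i) (y i)) j \<le> loc x j + loc y j"
    using second_difference(1)[of u v m] uv unfolding loc_def M xy m_def[symmetric] by simp
  assume "(x j - y j) * (x (j + 1) - y (j + 1)) < 0"
  then have "(v $ idx 0 * u $ idx 1 > 0) \<or> (u $ idx 0 * v $ idx 1 > 0)"
    using pos_idx[of 0] pos_idx[of 1] r_pos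
    by (auto simp: mult_less_0_iff u_def v_def m_def min_def)
  \<comment> \<open>Either sequence may be the larger one at \<open>j\<close>, so the strict
    inequality is used with \<open>u\<close> and \<open>v\<close> in both roles.\<close>
  then show "loc (\<lambda>i. min (x i) (y i)) j + loc (\<lambda>i. max (x i) (y i)) j < loc x j + loc y j"
    using second_difference(2)[of u v m] second_difference(2)[of v u m] uv
    unfolding loc_def M xy m_def[symmetric] by (auto simp: M(2))
qed

lemma loc_update_deriv:
  assumes "j \<le> i" "i \<le> j + int r"
  shows "((\<lambda>v. loc (x(i := v)) j) has_field_derivative dS (window x j) (axis (idx (nat (i - j))) 1)) (at (x i))"
proof -
  let ?e = "axis (idx (nat (i - j))) 1 :: (real, 'n) vec"
  have eq: "loc (x(i := v)) j = S (window x j + (v - x i) *\<^sub>R ?e)" for v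
  proof -
    have pi: "j + int (pos (idx (nat (i - j)) :: 'n)) = i"
      using assms pos_idx[of "nat (i - j)"] by auto
    have "k = idx (nat (i - j))" if "j + int (pos k) = i" for k :: 'n
      using that by (auto simp: idx_pos)
    then have "window (x(i := v)) j $ k = (window x j + (v - x i) *\<^sub>R ?e) $ k" for k
      by (cases "k = idx (nat (i - j))") (auto simp: axis_def pi)
    then show ?thesis unfolding loc_def by (intro arg_cong[of _ _ S]) (simp add: vec_eq_iff)
  qed
  have "((\<lambda>v. window x j + (v - x i) *\<^sub>R ?e) has_derivative (\<lambda>h. h *\<^sub>R ?e)) (at (x i))"
    by (auto intro!: derivative_eq_intros)
  from has_derivative_compose[OF this, of S "dS (window x j)"] dS[of "window x j"] show ?thesis
    unfolding eq by (simp add: has_field_derivative_def blinfun.scaleR_right mult_commute_abs)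
qed

text \<open>
  Touching at \<open>i\<close> is compared with the left neighbour only. The mixed derivative assumed to be negative
  is the one in the order \<open>(0, 1)\<close>, and using it in the order \<open>(1, 0)\<close> as well would require the symmetry
  of second derivatives.
\<close>

lemma strong_comparison:
  assumes le: "\<And>k. m k \<le> y k" and eq: "m i = y i" and less: "m (i - 1) < y (i - 1)"
    and crit: "\<And>v. (\<Sum>j\<in>{i - int r..i}. loc y j) \<le> (\<Sum>j\<in>{i - int r..i}. loc (y(i := v)) j)"
  shows "\<exists>v. (\<Sum>j\<in>{i - int r..i}. loc (m(i := v)) j) < (\<Sum>j\<in>{i - int r..i}. loc m j)"
proof -
  let ?e = "\<lambda>j. axis (idx (nat (i - j))) 1 :: (real, 'n) vec"
  let ?D = "\<lambda>x j. dS (window x j) (?e j)"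
  have d: "((\<lambda>v. \<Sum>j\<in>{i - int r..i}. loc (x(i := v)) j) has_field_derivative
      (\<Sum>j\<in>{i - int r..i}. ?D x j)) (at (x i))" for x
    by (intro DERIV_sum loc_update_deriv) auto
  have y0: "(\<Sum>j\<in>{i - int r..i}. ?D y j) = 0"
    by (rule DERIV_local_min[OF d, of 1]) (use crit in \<open>auto simp: fun_upd_triv\<close>)
  \<comment> \<open>The increment \<open>v\<close> from \<open>m\<close> to \<open>y\<close> is
    nonnegative and vanishes at \<open>i\<close>, so the derivative in site \<open>i\<close> does
    not grow along it. In the window at \<open>i - 1\<close> the sites \<open>i - 1\<close> and
    \<open>i\<close> are coordinates 0 and 1, and the decrease is strict.\<close>
  have cmp: "?D y j \<le> ?D m j \<and> (j = i - 1 \<longrightarrow> ?D y j < ?D m j)" if j: "j \<in> {i - int r..i}" for j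
  proof -
    define v :: "(real, 'n) vec" where "v = window y j - window m j"
    obtain z where z: "dS (window m j + v) (?e j) - dS (window m j) (?e j) = ddS z v (?e j)"
      using dS_diff by blast
    have pj: "int (pos (idx (nat (i - j)) :: 'n)) = i - j"
      using j pos_idx[of "nat (i - j)"] by auto
    have *: "\<And>k. ?e j $ k \<ge> 0" "\<And>k. v $ k \<ge> 0" "\<And>k. ?e j $ k * v $ k = 0"
      using le eq pj by (auto simp: axis_def v_def)
    have "ddS z v (?e j) < 0" if "j = i - 1"
    proof (rule ddS_disjoint(2)[OF *])
      show "v $ idx 0 * ?e j $ idx 1 > 0"
        using less that pos_idx[of 0] by (simp add: v_def axis_def)
    qed
    then show ?thesis using z ddS_disjoint(1)[OF *, of z] by (auto simp: v_def)
  qed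
  have "(\<Sum>j\<in>{i - int r..i}. ?D y j) < (\<Sum>j\<in>{i - int r..i}. ?D m j)"
    using cmp cmp[of "i - 1"] r_pos by (intro sum_strict_mono_ex1) (auto intro!: bexI[of _ "i - 1"])
  with y0 have "0 < (\<Sum>j\<in>{i - int r..i}. ?D m j)" by simp
  from DERIV_pos_inc_left[OF d this] obtain dd where "dd > 0"
    "\<forall>h>0. h < dd \<longrightarrow> (\<Sum>j\<in>{i - int r..i}. loc (m(i := m i - h)) j) < (\<Sum>j\<in>{i - int r..i}. loc (m(i := m i)) j)"
    by blast
  then show ?thesis
    by (intro exI[of _ "m i - dd / 2"]) (auto simp: fun_upd_triv)
qed

end

section \<open>Translations and existence of minimisers\<close>

lemma sum_period_shift:
  fixes f :: "int \<Rightarrow> 'a::comm_monoid_add" and p :: int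
  assumes "\<And>j. f (j + p) = f j" and "p \<ge> 0"
  shows "sum f {s..<s + p} = sum f {0..<p}"
proof -
  have step: "sum f {i..<i + p} = sum f {i + 1..<i + 1 + p}" for i
  proof (cases "p = 0")
    case False
    then have "{i..<i + p} = insert i {i + 1..<i + p}" "{i + 1..<i + 1 + p} = insert (i + p) {i + 1..<i + p}"
      using \<open>p \<ge> 0\<close> by auto
    then show ?thesis using assms(1)[of i] by simp
  qed simp
  show ?thesis
  proof (induction s rule: int_induct[of _ 0])
    case (step2 i)
    then show ?case using step[of "i - 1"] by simp
  qed (use step in auto)
qed

lemma sum_int_split:
  fixes f :: "int \<Rightarrow> 'a::comm_monoid_add"
  assumes "a \<le> b" "b \<le> c"
  shows "sum f {a..<c} = sum f {a..<b} + sum f {b..<c}"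
  by (subst ivl_disj_un_two(3)[OF assms, symmetric]) (rule sum.union_disjoint, auto)

lemma atLeastLessThan_int_single [simp]: "{j..<j + 1} = {j :: int}"
  by auto

text \<open>A diagonal argument. Dividing by \<open>c i\<close> turns the bounds \<open>b i\<close>
  into the common bound 1; the summand 1 in \<open>c i\<close> keeps it positive.\<close>

lemma pointwise_convergent_subsequence:
  fixes f :: "nat \<Rightarrow> 'a::countable \<Rightarrow> real"
  assumes "\<And>n i. \<bar>f n i\<bar> \<le> b i"
  obtains \<phi> g where "strict_mono \<phi>" "\<And>i. (\<lambda>n. f (\<phi> n) i) \<longlonglongrightarrow> g i"
proof -
  define c where "c i = b i + 1" for i
  have c: "c i > 0" for i using assms[of 0 i] by (simp add: c_def)
  have "norm (f n i / c i) \<le> 1" for n i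
    using assms[of n i] c[of i] by (simp add: c_def)
  then obtain \<phi> where \<phi>: "strict_mono (\<phi> :: nat \<Rightarrow> nat)"
    "\<And>i. \<exists>l. (\<lambda>n. f (\<phi> n) i / c i) \<longlonglongrightarrow> l"
    using function_convergent_subsequence[of UNIV "\<lambda>n i. f n i / c i" 1] by (metis UNIV_I countableI_type)
  have "\<exists>l. (\<lambda>n. f (\<phi> n) i) \<longlonglongrightarrow> l" for i
  proof -
    obtain l where "(\<lambda>n. f (\<phi> n) i / c i) \<longlonglongrightarrow> l" using \<phi>(2) by blast
    from tendsto_mult_right[OF this, of "c i"] c[of i] show ?thesis by auto
  qed
  then show thesis using that \<phi>(1) by metis
qed

text \<open>On sequences of rotation number \<open>\<omega>\<close> this raises the mean height by
  \<open>k * \<omega> + l\<close>. That number, called height below, is what orders the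
  translates.\<close>

definition translate :: "int \<Rightarrow> int \<Rightarrow> (int \<Rightarrow> real) \<Rightarrow> int \<Rightarrow> real" where
  "translate k l x i = x (i + k) + of_int l"

lemma periodic_seqs_iff: "x \<in> periodic_seqs p q \<longleftrightarrow> (\<forall>i. x (i + p) = x i + of_int q)"
proof
  assume "x \<in> periodic_seqs p q"
  then have *: "x (i - p) + of_int q = x i" for i by (simp add: periodic_seqs_def)
  show "\<forall>i. x (i + p) = x i + of_int q" using *[of "_ + p"] by simp
next
  assume *: "\<forall>i. x (i + p) = x i + of_int q"
  have "x (i - p) + of_int q = x i" for i using *[rule_format, of "i - p"] by simp
  then show "x \<in> periodic_seqs p q" by (simp add: periodic_seqs_def)
qed

lemma translate_periodic:
  assumes "x \<in> periodic_seqs p q"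
  shows "translate k l x \<in> periodic_seqs p q"
proof -
  have "x (i + k + p) = x (i + k) + of_int q" for i
    using assms unfolding periodic_seqs_iff by blast
  then show ?thesis unfolding periodic_seqs_iff translate_def by (simp add: add_ac)
qed

lemma min_max_periodic:
  assumes "x \<in> periodic_seqs p q" "y \<in> periodic_seqs p q"
  shows "(\<lambda>i. min (x i) (y i)) \<in> periodic_seqs p q" "(\<lambda>i. max (x i) (y i)) \<in> periodic_seqs p q"
  using assms unfolding periodic_seqs_iff by auto

lemma linear_periodic:
  assumes "p \<ge> 1"
  shows "(\<lambda>i. \<xi> + of_int i * (of_int q / of_int p)) \<in> periodic_seqs p q"
  using assms unfolding periodic_seqs_iff by (auto simp: field_simps)

section \<open>Compactness of windows and existence of periodic minimisers\<close>

context local_potential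
begin

text \<open>Bounded oscillation on every window. Modulo integer translation the windows of tame
  sequences lie in one compact box, which makes bounds and moduli of continuity of \<open>S\<close>
  uniform in the site.\<close>

definition tame :: "real \<Rightarrow> (int \<Rightarrow> real) \<Rightarrow> bool" where
  "tame K x \<longleftrightarrow> (\<forall>i j. \<bar>i - j\<bar> \<le> int r \<longrightarrow> \<bar>x i - x j\<bar> \<le> K)"

lemma tame_windowD:
  assumes "tame K x"
  shows "\<bar>x (j + int (pos (i::'n))) - x j\<bar> \<le> K"
  using assms pos_le_r[of i] unfolding tame_def by simp

lemma loc_translate: "loc (translate k l x) j = loc x (j + k)"
proof -
  have "translate k l x = (\<lambda>i. (\<lambda>i. x (i + k)) i + of_int l)" by (simp add: fun_eq_iff translate_def)
  then show ?thesis using loc_add_int[of "\<lambda>i. x (i + k)" l j] loc_shift[of x k j] by simp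
qed

text \<open>Subtracting the integer part of \<open>x j\<close> leaves its first entry in [0, 1),
  whence the bound \<open>K + 1\<close>. The clause about \<open>v\<close> lets the same shift serve
  sequences close to \<open>x\<close>.\<close>

lemma loc_normalise: "tame K x \<Longrightarrow> \<exists>w\<in>cbox (\<chi> i. - (K + 1)) (\<chi> i. K + 1).
    loc x j = S w \<and> (\<forall>v. S (w + v) = S (window x j + v))"
proof -
  assume x: "tame K x"
  define w :: "(real, 'n) vec" where "w = (\<chi> i. window x j $ i + of_int (- \<lfloor>x j\<rfloor>))"
  have "\<bar>w $ i\<bar> \<le> K + 1" for i
    using tame_windowD[OF x, of j i] unfolding w_def by (simp, linarith)
  then have "w \<in> cbox (\<chi> i. - (K + 1)) (\<chi> i. K + 1)"
    unfolding mem_box_cart by (simp add: abs_le_iff minus_le_iff) (smt (verit))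
  moreover have "S (w + v) = S (window x j + v)" for v
  proof -
    have "w + v = (\<chi> i. (window x j + v) $ i + of_int (- \<lfloor>x j\<rfloor>))"
      by (simp add: vec_eq_iff w_def)
    then show ?thesis using S_add_int by metis
  qed
  moreover have "loc x j = S w" using S_add_int unfolding w_def loc_def by metis
  ultimately show ?thesis by blast
qed

lemma loc_uniformly_continuous:
  assumes "\<epsilon> > 0"
  shows "\<exists>\<eta>>0. \<forall>x z j. tame K x \<longrightarrow> (\<forall>i. j \<le> i \<and> i \<le> j + int r \<longrightarrow> \<bar>z i - x i\<bar> \<le> \<eta>) \<longrightarrow>
     \<bar>loc z j - loc x j\<bar> \<le> \<epsilon>"
proof -
  let ?C = "cbox (\<chi> i. - (K + 2)) (\<chi> i. K + 2) :: (real, 'n) vec set"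
  have "uniformly_continuous_on ?C S"
    by (intro compact_uniformly_continuous continuous_S compact_cbox)
  then obtain d where d: "d > 0" "\<And>x y. x \<in> ?C \<Longrightarrow> y \<in> ?C \<Longrightarrow> dist x y < d \<Longrightarrow> dist (S x) (S y) < \<epsilon>"
    unfolding uniformly_continuous_on_def using assms by metis
  \<comment> \<open>The norm of the difference of two windows is at most the sum of its
    \<open>r + 1\<close> entries, which must stay below \<open>d\<close>; the bound 1 keeps the
    perturbed window in the box of size \<open>K + 2\<close>.\<close>
  define \<eta> where "\<eta> = min 1 (d / (2 * (real r + 1)))"
  have \<eta>: "\<eta> > 0" "\<eta> \<le> 1" "(real r + 1) * \<eta> < d"
  proof -
    have "(real r + 1) * \<eta> \<le> (real r + 1) * (d / (2 * (real r + 1)))"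
      by (intro mult_left_mono) (auto simp: \<eta>_def)
    also have "\<dots> = d / 2" by (simp add: field_simps)
    finally show "(real r + 1) * \<eta> < d" using d(1) by simp
  qed (use d(1) in \<open>auto simp: \<eta>_def\<close>)
  show ?thesis
  proof (intro exI[of _ \<eta>] conjI allI impI \<eta>(1))
    fix x z j
    assume x: "tame K x" and z: "\<forall>i. j \<le> i \<and> i \<le> j + int r \<longrightarrow> \<bar>z i - x i\<bar> \<le> \<eta>"
    obtain w where w: "w \<in> cbox (\<chi> i. - (K + 1)) (\<chi> i. K + 1)" "loc x j = S w"
      "\<And>v. S (w + v) = S (window x j + v)"
      using loc_normalise[OF x] by blast
    define v :: "(real, 'n) vec" where "v = window z j - window x j"
    have v: "\<bar>v $ i\<bar> \<le> \<eta>" for i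
      using z[rule_format, of "j + int (pos i)"] pos_le_r[of i] by (simp add: v_def)
    have z: "loc z j = S (w + v)" unfolding w(3) by (simp add: v_def loc_def)
    have "norm v \<le> (\<Sum>i\<in>UNIV. \<bar>v $ i\<bar>)" by (rule norm_le_l1_cart)
    also have "\<dots> \<le> (\<Sum>i\<in>(UNIV :: 'n set). \<eta>)" by (intro sum_mono v)
    also have "\<dots> < d" using \<eta>(3) card_r by (simp add: algebra_simps)
    finally have nv: "norm v < d" .
    have wi: "- (K + 1) \<le> w $ i" "w $ i \<le> K + 1" for i
      using w(1) unfolding mem_box_cart by auto
    have vi: "- 1 \<le> v $ i" "v $ i \<le> 1" for i
      using v[of i] \<eta>(2) by linarith+
    have "w \<in> ?C" unfolding mem_box_cart using wi by (auto intro: order_trans[OF _ wi(1)] order_trans[OF wi(2)])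
    moreover have "w + v \<in> ?C" unfolding mem_box_cart
    proof (intro allI conjI)
      fix i show "(\<chi> i. - (K + 2)) $ i \<le> (w + v) $ i" "(w + v) $ i \<le> (\<chi> i. K + 2) $ i"
        using wi[of i] vi[of i] by simp_all
    qed
    ultimately have "dist (S (w + v)) (S w) < \<epsilon>"
      using d(2) nv by (simp add: dist_norm)
    then show "\<bar>loc z j - loc x j\<bar> \<le> \<epsilon>" unfolding z w(2) by (simp add: dist_real_def)
  qed
qed

lemma loc_bounded: "\<exists>B. \<forall>x j. tame K x \<longrightarrow> \<bar>loc x j\<bar> \<le> B"
proof -
  let ?C = "cbox (\<chi> i. - (K + 1)) (\<chi> i. K + 1) :: (real, 'n) vec set"
  have "bounded (S ` ?C)"
    by (intro compact_imp_bounded compact_continuous_image continuous_S compact_cbox)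
  then obtain B where "\<And>w. w \<in> ?C \<Longrightarrow> \<bar>S w\<bar> \<le> B" unfolding bounded_iff by auto
  then show ?thesis using loc_normalise by metis
qed

lemma loc_tendsto:
  assumes "\<And>i. ((\<lambda>n. x n i) \<longlongrightarrow> y i) F"
  shows "((\<lambda>n. loc (x n) j) \<longlongrightarrow> loc y j) F"
proof -
  have "((\<lambda>n. window (x n) j :: (real, 'n) vec) \<longlongrightarrow> window y j) F"
    by (rule vec_tendstoI) (simp add: assms)
  then show ?thesis unfolding loc_def
    using continuous_S[of UNIV] by (auto intro: continuous_on_tendsto_compose)
qed

lemma action_tendsto:
  "(\<And>i. (\<lambda>n. x n i) \<longlonglongrightarrow> y i) \<Longrightarrow> (\<lambda>n. action S p (x n)) \<longlonglongrightarrow> action S p y"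
  unfolding action_eq by (intro tendsto_sum loc_tendsto)

lemma loc_periodic: "x \<in> periodic_seqs p q \<Longrightarrow> loc x (j + p) = loc x j"
proof -
  assume "x \<in> periodic_seqs p q"
  then have "translate p (- q) x = x"
    unfolding periodic_seqs_iff translate_def by (auto simp: fun_eq_iff)
  then show ?thesis using loc_translate[of p "- q" x j] by simp
qed

lemma action_shift: "x \<in> periodic_seqs p q \<Longrightarrow> p \<ge> 0 \<Longrightarrow> action S p x = (\<Sum>j\<in>{s..<s + p}. loc x j)"
  unfolding action_eq using sum_period_shift[of "loc x" p s] loc_periodic by simp

lemma action_translate:
  assumes "x \<in> periodic_seqs p q" "p \<ge> 0"
  shows "action S p (translate k l x) = action S p x"
proof -
  have "action S p (translate k l x) = (\<Sum>j\<in>{0..<p}. loc x (j + k))"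
    by (simp add: action_eq loc_translate)
  also have "\<dots> = (\<Sum>j\<in>{k..<k + p}. loc x j)"
    by (rule sum.reindex_bij_witness[of _ "\<lambda>j. j - k" "\<lambda>j. j + k"]) auto
  also have "\<dots> = action S p x" using action_shift[OF assms] by simp
  finally show ?thesis .
qed

lemma action_min_max:
  "action S p (\<lambda>i. min (x i) (y i)) + action S p (\<lambda>i. max (x i) (y i)) \<le> action S p x + action S p y"
  unfolding action_eq sum.distrib[symmetric] by (intro sum_mono loc_crossing)

text \<open>Coercivity controls a single pair of adjacent coordinates, but sliding the window brings
  this pair over every two adjacent sites.\<close>

lemma coercive_step:
  "\<exists>K. \<forall>x. (\<forall>j. loc x j \<le> C) \<longrightarrow> (\<forall>i. \<bar>x (i + 1) - x i\<bar> \<le> K)"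
proof -
  obtain i i' :: 'n where i: "pos i' = pos i + 1"
    and "filterlim S at_top (filtercomap (\<lambda>x. \<bar>x $ i' - x $ i\<bar>) at_top)"
    using coer unfolding coercivity_def by blast
  then have "\<forall>\<^sub>F x in filtercomap (\<lambda>x. \<bar>x $ i' - x $ i\<bar>) at_top. S x > C"
    by (simp add: filterlim_at_top_dense)
  then obtain P where P: "eventually P (at_top :: real filter)" "\<And>x. P \<bar>x $ i' - x $ i\<bar> \<Longrightarrow> S x > C"
    unfolding eventually_filtercomap by blast
  then obtain K where K: "\<And>t. t \<ge> K \<Longrightarrow> P t" unfolding eventually_at_top_linorder by blast
  have step: "\<bar>x (j + int (pos i) + 1) - x (j + int (pos i))\<bar> \<le> K" if "loc x j \<le> C" for x j
  proof (rule ccontr)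
    assume "\<not> ?thesis"
    then have "P \<bar>window x j $ i' - window x j $ i\<bar>" by (intro K) (simp add: i algebra_simps)
    then show False using P(2) that unfolding loc_def by fastforce
  qed
  have "\<bar>x (k + 1) - x k\<bar> \<le> K" if "\<And>j. loc x j \<le> C" for x k
    using step[of x "k - int (pos i)"] that by simp
  then show ?thesis by blast
qed

text \<open>The set \<open>A\<close> is abstract so that free and constrained minimisation are both
  covered. Bounded action bounds the steps of a sequence but not its position; \<open>normal\<close>
  fixes the position at site 0, and compactness does the rest.\<close>

lemma minimiser_exists:
  assumes p: "p \<ge> 1" and A: "A \<subseteq> periodic_seqs p q" "A \<noteq> {}"
    and closed: "\<And>x y. (\<And>n. x n \<in> A) \<Longrightarrow> (\<And>i. (\<lambda>n. x n i) \<longlonglongrightarrow> y i) \<Longrightarrow> y \<in> A"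
    and normal: "\<And>x. x \<in> A \<Longrightarrow> \<exists>x'\<in>A. action S p x' = action S p x \<and> \<bar>x' 0\<bar> \<le> C"
  shows "\<exists>y\<in>A. \<forall>x\<in>A. action S p y \<le> action S p x"
proof -
  obtain B where B: "\<And>w. B \<le> S w"
    using coer unfolding coercivity_def bdd_below_def by auto
  then have locB: "B \<le> loc x j" for x j unfolding loc_def by simp
  have "of_int p * B \<le> action S p x" for x
    using sum_bounded_below[of "{0..<p}" B "loc x"] locB p unfolding action_eq by simp
  then have bdd: "bdd_below (action S p ` A)" unfolding bdd_below_def by auto
  define m where "m = Inf (action S p ` A)"
  have "\<exists>x\<in>A. action S p x < m + inverse (real (Suc n)) \<and> \<bar>x 0\<bar> \<le> C" for n
  proof -
    have "\<exists>w\<in>action S p ` A. w < m + inverse (real (Suc n))"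
      by (rule cInf_lessD) (use A(2) in \<open>simp_all add: m_def\<close>)
    then obtain x where "x \<in> A" "action S p x < m + inverse (real (Suc n))" by blast
    then show ?thesis using normal by metis
  qed
  then obtain x where x: "\<And>n. x n \<in> A" "\<And>n. action S p (x n) < m + inverse (real (Suc n))"
    "\<And>n. \<bar>x n 0\<bar> \<le> C" by metis
  \<comment> \<open>One term of the action is at most the action minus the lower bound
    \<open>B\<close> for each of the other \<open>p - 1\<close> terms.\<close>
  obtain K where K: "\<forall>x. (\<forall>j. loc x j \<le> m + 1 - of_int (p - 1) * B) \<longrightarrow> (\<forall>i. \<bar>x (i + 1) - x i\<bar> \<le> K)"
    using coercive_step by blast
  have step: "\<bar>x n (i + 1) - x n i\<bar> \<le> K" for n i
  proof (rule K[rule_format])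
    fix j
    have "action S p (x n) = (\<Sum>i\<in>{j..<j + p}. loc (x n) i)"
      using action_shift x(1) A(1) p by fastforce
    also have "\<dots> = loc (x n) j + (\<Sum>i\<in>{j + 1..<j + p}. loc (x n) i)"
      using p sum_int_split[of j "j + 1" "j + p" "loc (x n)"] by simp
    also have "\<dots> \<ge> loc (x n) j + of_int (p - 1) * B"
      using sum_bounded_below[of "{j + 1..<j + p}" B "loc (x n)"] locB p by simp
    finally have "loc (x n) j \<le> action S p (x n) - of_int (p - 1) * B" by simp
    moreover have "action S p (x n) \<le> m + 1"
      using x(2)[of n] inverse_le_1_iff[of "real (Suc n)"] by simp
    ultimately show "loc (x n) j \<le> m + 1 - of_int (p - 1) * B" by simp
  qed
  have bound: "\<bar>x n i - x n 0\<bar> \<le> of_int \<bar>i\<bar> * K" for n i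
  proof (induction i rule: int_induct[of _ 0])
    case (step1 i)
    then show ?case using step[of n i] by (simp add: algebra_simps)
  next
    case (step2 i)
    then show ?case using step[of n "i - 1"] by (simp add: algebra_simps)
  qed simp
  have b: "\<bar>x n i\<bar> \<le> C + of_int \<bar>i\<bar> * K" for n i
    using bound[of n i] x(3)[of n] by linarith
  obtain \<phi> y where \<phi>: "strict_mono \<phi>" and y: "\<And>i. (\<lambda>n. x (\<phi> n) i) \<longlonglongrightarrow> y i"
    using pointwise_convergent_subsequence[of x, OF b] by metis
  have "y \<in> A" using closed[of "\<lambda>n. x (\<phi> n)" y] x(1) y by blast
  have "action S p y \<le> m"
  proof (rule tendsto_le[OF _ _ action_tendsto[OF y]])
    have "(\<lambda>n. inverse (real (Suc (\<phi> n)))) \<longlonglongrightarrow> 0"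
      using LIMSEQ_subseq_LIMSEQ[OF LIMSEQ_inverse_real_of_nat \<phi>] by (simp add: o_def)
    from tendsto_add[OF tendsto_const this, of m]
    show "(\<lambda>n. m + inverse (real (Suc (\<phi> n)))) \<longlonglongrightarrow> m" by simp
    show "\<forall>\<^sub>F n in sequentially. action S p (x (\<phi> n)) \<le> m + inverse (real (Suc (\<phi> n)))"
      using x(2) by (auto intro!: always_eventually less_imp_le)
  qed simp
  moreover have "m \<le> action S p z" if "z \<in> A" for z
    unfolding m_def using that bdd by (simp add: cInf_lower)
  ultimately show ?thesis using \<open>y \<in> A\<close> by (meson order_trans)
qed

definition minimiser :: "int \<Rightarrow> int \<Rightarrow> (int \<Rightarrow> real) \<Rightarrow> bool" where
  "minimiser p q y \<longleftrightarrow> y \<in> periodic_seqs p q \<and> (\<forall>x\<in>periodic_seqs p q. action S p y \<le> action S p x)"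

lemma periodic_seqs_closed:
  assumes "\<And>n. x n \<in> periodic_seqs p q" "\<And>i. (\<lambda>n. x n i) \<longlonglongrightarrow> y i"
  shows "y \<in> periodic_seqs p q"
  unfolding periodic_seqs_iff
proof
  fix i
  have "(\<lambda>n. x n i + of_int q) \<longlonglongrightarrow> y i + of_int q" by (intro tendsto_intros assms)
  then have "(\<lambda>n. x n (i + p)) \<longlonglongrightarrow> y i + of_int q"
    using assms(1) unfolding periodic_seqs_iff by simp
  then show "y (i + p) = y i + of_int q" using assms(2) LIMSEQ_unique by blast
qed

lemma ex_minimiser:
  assumes "p \<ge> 1"
  shows "\<exists>y. minimiser p q y"
proof -
  have "\<exists>y\<in>periodic_seqs p q. \<forall>x\<in>periodic_seqs p q. action S p y \<le> action S p x"
  proof (rule minimiser_exists[OF assms order_refl])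
    show "periodic_seqs p q \<noteq> {}" using linear_periodic[OF assms] by blast
    fix x assume x: "x \<in> periodic_seqs p q"
    have "\<bar>translate 0 (- \<lfloor>x 0\<rfloor>) x 0\<bar> \<le> 1" unfolding translate_def by (simp, linarith)
    then show "\<exists>x'\<in>periodic_seqs p q. action S p x' = action S p x \<and> \<bar>x' 0\<bar> \<le> 1"
      using action_translate[OF x] translate_periodic[OF x] assms by (metis order_trans zero_le_one)
  qed (rule periodic_seqs_closed)
  then show ?thesis unfolding minimiser_def by blast
qed

lemma ex_constrained_minimiser:
  assumes "p \<ge> 1"
  shows "\<exists>y\<in>{x \<in> periodic_seqs p q. x 0 = \<xi>}. \<forall>x\<in>{x \<in> periodic_seqs p q. x 0 = \<xi>}. action S p y \<le> action S p x"
proof (rule minimiser_exists[OF assms])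
  show "{x \<in> periodic_seqs p q. x 0 = \<xi>} \<noteq> {}" using linear_periodic[OF assms, of \<xi> q] by auto
  show "y \<in> {x \<in> periodic_seqs p q. x 0 = \<xi>}"
    if "\<And>n. x n \<in> {x \<in> periodic_seqs p q. x 0 = \<xi>}" "\<And>i. (\<lambda>n. x n i) \<longlonglongrightarrow> y i" for x :: "nat \<Rightarrow> _" and y
    using periodic_seqs_closed[of x p q y] that that(2)[of 0] by (auto simp: LIMSEQ_const_iff)
  show "\<exists>x'\<in>{x \<in> periodic_seqs p q. x 0 = \<xi>}. action S p x' = action S p x \<and> \<bar>x' 0\<bar> \<le> \<bar>\<xi>\<bar>"
    if "x \<in> {x \<in> periodic_seqs p q. x 0 = \<xi>}" for x using that by blast
qed blast

end

section \<open>Ordering of minimisers\<close>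

lemma periodic_extension:
  assumes "p \<ge> 1"
  obtains x where "x \<in> periodic_seqs p q" "\<And>i. b \<le> i \<Longrightarrow> i < b + p \<Longrightarrow> x i = z i"
proof
  define x where "x i = z (b + (i - b) mod p) + of_int q * of_int ((i - b) div p)" for i
  have "i + p - b = (i - b) + p" for i :: int by simp
  then have "(i + p - b) mod p = (i - b) mod p" "(i + p - b) div p = (i - b) div p + 1" for i
    using assms by (metis mod_add_self2, metis div_add_self2 not_one_le_zero)
  then show "x \<in> periodic_seqs p q"
    unfolding periodic_seqs_iff x_def by (simp add: algebra_simps)
  show "x i = z i" if "b \<le> i" "i < b + p" for i
    using that by (simp add: x_def)
qed

text \<open>Here \<open>d\<close> will be the difference of two minimisers. Strong comparison passes
  zeros to the left only, so the degenerate case yields vanishing on a left half-line; periodicity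
  or recurrence has to extend it.\<close>

lemma constant_sign_or_zero:
  fixes d :: "int \<Rightarrow> real"
  assumes cross: "\<And>j. \<not> d j * d (j + 1) < 0" and zero: "\<And>j. d j = 0 \<Longrightarrow> d (j - 1) = 0"
  shows "(\<forall>j. d j > 0) \<or> (\<forall>j. d j < 0) \<or> (\<exists>J. \<forall>j\<le>J. d j = 0)"
proof (cases "\<exists>J. d J = 0")
  case True
  then obtain J where J: "d J = 0" by blast
  have "d j = 0" if "j \<le> J" for j
    using that J zero by (induction j rule: int_le_induct) auto
  then show ?thesis by blast
next
  case False
  have step: "d j > 0 \<longleftrightarrow> d (j + 1) > 0" for j
    using cross[of j] False by (smt (verit) mult_less_0_iff)
  have "d j > 0 \<longleftrightarrow> d 0 > 0" for j
  proof (induction j rule: int_induct[of _ 0])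
    case (step2 i)
    then show ?case using step[of "i - 1"] by simp
  qed (use step in auto)
  then show ?thesis using False by (smt (verit))
qed

text \<open>Only translates of strictly positive height are compared. This condition is open in
  \<open>\<omega>\<close>, so the property survives limits in which the rotation number
  varies.\<close>

definition birkhoff :: "real \<Rightarrow> (int \<Rightarrow> real) \<Rightarrow> bool" where
  "birkhoff \<omega> y \<longleftrightarrow> (\<forall>k l i. of_int k * \<omega> + of_int l > 0 \<longrightarrow> y i \<le> y (i + k) + of_int l)"

lemma birkhoff_le: "birkhoff \<omega> y \<Longrightarrow> of_int k * \<omega> + of_int l > 0 \<Longrightarrow> y i \<le> y (i + k) + of_int l"
  unfolding birkhoff_def by blast

text \<open>In the 2, one unit is due to rounding \<open>k * \<omega>\<close> to an integer and one
  to the strictness of the height condition.\<close>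

lemma birkhoff_deviation:
  assumes "birkhoff \<omega> y"
  shows "\<bar>y (i + k) - y i - of_int k * \<omega>\<bar> \<le> 2"
proof -
  have 1: "y i \<le> y (i + k) + of_int (1 - \<lfloor>of_int k * \<omega>\<rfloor>)"
    by (rule birkhoff_le[OF assms]) (simp, linarith)
  have 2: "y (i + k) \<le> y (i + k + (- k)) + of_int (1 + \<lceil>of_int k * \<omega>\<rceil>)"
    by (rule birkhoff_le[OF assms]) (simp, linarith)
  show ?thesis using 1 2 by (simp, linarith)
qed

lemma birkhoff_translate:
  assumes "birkhoff \<omega> y"
  shows "birkhoff \<omega> (translate k l y)"
  unfolding birkhoff_def translate_def
  using birkhoff_le[OF assms, of _ _ "_ + k"] by (simp add: add_ac)

lemma birkhoff_translate_mono:
  assumes "birkhoff \<omega> y" "of_int k * \<omega> + of_int l < of_int k' * \<omega> + of_int l'"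
  shows "translate k l y i \<le> translate k' l' y i"
  using birkhoff_le[OF assms(1), of "k' - k" "l' - l" "i + k"] assms(2)
  by (simp add: translate_def algebra_simps)

lemma birkhoff_limit:
  assumes "\<And>n. birkhoff (w n) (y n)" "w \<longlonglongrightarrow> \<omega>" "\<And>i. (\<lambda>n. y n i) \<longlonglongrightarrow> x i"
  shows "birkhoff \<omega> x"
  unfolding birkhoff_def
proof (intro allI impI)
  fix k l i :: int
  assume *: "of_int k * \<omega> + of_int l > 0"
  have "(\<lambda>n. of_int k * w n + of_int l) \<longlonglongrightarrow> of_int k * \<omega> + of_int l"
    by (intro tendsto_intros assms)
  then have "\<forall>\<^sub>F n in sequentially. of_int k * w n + of_int l > 0"
    using * order_tendstoD(1) by blast
  then have "\<forall>\<^sub>F n in sequentially. y n i \<le> y n (i + k) + of_int l"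
    by eventually_elim (rule birkhoff_le[OF assms(1)])
  then show "x i \<le> x (i + k) + of_int l"
    by (intro tendsto_le[OF _ tendsto_add[OF assms(3) tendsto_const] assms(3)]) auto
qed

section \<open>Periodic minimisers are Birkhoff and converge to ground states\<close>

context local_potential
begin

lemma minimiser_periodic: "minimiser p q y \<Longrightarrow> y \<in> periodic_seqs p q"
  by (simp add: minimiser_def)

lemma minimiser_translate: "minimiser p q y \<Longrightarrow> p \<ge> 0 \<Longrightarrow> minimiser p q (translate k l y)"
  unfolding minimiser_def using action_translate by (auto simp: translate_periodic)

lemma birkhoff_tame:
  assumes "birkhoff \<omega> y"
  shows "tame (real r * \<bar>\<omega>\<bar> + 2) y"
  unfolding tame_def
proof (intro allI impI)
  fix i j :: int
  assume "\<bar>i - j\<bar> \<le> int r"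
  then have "\<bar>of_int (i - j) * \<omega>\<bar> \<le> real r * \<bar>\<omega>\<bar>"
    by (simp add: abs_mult) (intro mult_right_mono, linarith, simp)
  then show "\<bar>y i - y j\<bar> \<le> real r * \<bar>\<omega>\<bar> + 2"
    using birkhoff_deviation[OF assms, of j "i - j"] by simp
qed

text \<open>A variation on the sites from \<open>s\<close> to \<open>t - 1\<close> affects exactly
  the windows starting in \<open>{s - int r..<t}\<close>. The length bound \<open>m\<close> is kept
  because a periodic minimiser is compared only with variations fitting into one period.\<close>

definition locally_minimal :: "int \<Rightarrow> (int \<Rightarrow> real) \<Rightarrow> bool" where
  "locally_minimal m y \<longleftrightarrow> (\<forall>z s t. s \<le> t \<longrightarrow> t - s \<le> m \<longrightarrow> (\<forall>i. i < s \<or> t \<le> i \<longrightarrow> z i = y i) \<longrightarrow>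
     (\<Sum>j\<in>{s - int r..<t}. loc y j) \<le> (\<Sum>j\<in>{s - int r..<t}. loc z j))"

lemma locally_minimalD:
  assumes "locally_minimal m y" "s \<le> t" "t - s \<le> m" "\<And>i. i < s \<or> t \<le> i \<Longrightarrow> z i = y i"
  shows "(\<Sum>j\<in>{s - int r..<t}. loc y j) \<le> (\<Sum>j\<in>{s - int r..<t}. loc z j)"
  using assms unfolding locally_minimal_def by blast

text \<open>The varied sites and the \<open>r\<close> sites before them fit into one period, so the
  variation can be repeated periodically and becomes an admissible competitor.\<close>

lemma minimiser_locally_minimal:
  assumes y: "minimiser p q y" and p: "p \<ge> 1"
  shows "locally_minimal (p - int r) y"
  unfolding locally_minimal_def
proof (intro allI impI)
  fix z s t
  assume st: "s \<le> t" "t - s \<le> p - int r" and z: "\<forall>i. i < s \<or> t \<le> i \<longrightarrow> z i = y i"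
  define b where "b = s - int r"
  obtain x where x: "x \<in> periodic_seqs p q" "\<And>i. b \<le> i \<Longrightarrow> i < b + p \<Longrightarrow> x i = z i"
    using periodic_extension[OF p] by metis
  \<comment> \<open>Windows starting in the period reach up to \<open>r\<close> sites beyond it.
    There the periodic sequence repeats the first \<open>r\<close> sites, which lie before
    \<open>s\<close> and carry the values of \<open>y\<close>.\<close>
  have xz: "x i = z i" if "b \<le> i" "i < b + p + int r" for i
  proof (cases "i < b + p")
    case False
    have "x i = x (i - p) + of_int q" "y i = y (i - p) + of_int q"
      using x(1) minimiser_periodic[OF y] unfolding periodic_seqs_def by auto
    moreover have "x (i - p) = z (i - p)" using False that st by (intro x(2)) auto
    moreover have "z (i - p) = y (i - p)" "z i = y i"
      using z False that st by (auto simp: b_def)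
    ultimately show ?thesis by simp
  qed (use that x(2) in auto)
  have tb: "b \<le> t" "t \<le> b + p" using st by (auto simp: b_def)
  have "action S p y \<le> action S p x" using y x(1) unfolding minimiser_def by blast
  moreover have "action S p x = (\<Sum>j\<in>{b..<b + p}. loc x j)"
    using action_shift x(1) p by simp
  moreover have "\<dots> = (\<Sum>j\<in>{b..<b + p}. loc z j)"
    by (intro sum.cong refl loc_cong xz) auto
  moreover have "\<dots> = (\<Sum>j\<in>{b..<t}. loc z j) + (\<Sum>j\<in>{t..<b + p}. loc z j)"
    by (intro sum_int_split tb)
  moreover have "(\<Sum>j\<in>{t..<b + p}. loc z j) = (\<Sum>j\<in>{t..<b + p}. loc y j)"
    using z by (intro sum.cong refl loc_cong) auto
  moreover have "action S p y = (\<Sum>j\<in>{b..<b + p}. loc y j)"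
    using action_shift[OF minimiser_periodic[OF y]] p by simp
  moreover have "\<dots> = (\<Sum>j\<in>{b..<t}. loc y j) + (\<Sum>j\<in>{t..<b + p}. loc y j)"
    by (intro sum_int_split tb)
  ultimately show "(\<Sum>j\<in>{s - int r..<t}. loc y j) \<le> (\<Sum>j\<in>{s - int r..<t}. loc z j)"
    unfolding b_def by linarith
qed

lemma coordinate_minimal:
  assumes "locally_minimal m y" "m \<ge> 1"
  shows "(\<Sum>j\<in>{i - int r..i}. loc y j) \<le> (\<Sum>j\<in>{i - int r..i}. loc (y(i := v)) j)"
proof -
  have "{i - int r..<i + 1} = {i - int r..i}" by auto
  then show ?thesis using locally_minimalD[OF assms(1), of i "i + 1" "y(i := v)"] assms(2) by fastforce
qed

text \<open>Minimum and maximum are admissible, so each has at least the minimal action, and by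
  submodularity together they have at most twice the minimum.\<close>

lemma min_max_minimiser:
  assumes "minimiser p q y" "minimiser p q z"
  shows "minimiser p q (\<lambda>i. min (y i) (z i))"
    and "action S p (\<lambda>i. min (y i) (z i)) + action S p (\<lambda>i. max (y i) (z i)) = action S p y + action S p z"
proof -
  have *: "y \<in> periodic_seqs p q" "z \<in> periodic_seqs p q"
    using assms minimiser_periodic by auto
  have **: "action S p y \<le> action S p (\<lambda>i. max (y i) (z i))" "action S p y \<le> action S p (\<lambda>i. min (y i) (z i))"
     "action S p z = action S p y"
    using assms min_max_periodic[OF *] * unfolding minimiser_def by (auto intro!: order_antisym)
  then have "action S p (\<lambda>i. min (y i) (z i)) = action S p y"
    using action_min_max[of p y z] by linarith
  then show "minimiser p q (\<lambda>i. min (y i) (z i))"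
    using assms(1) min_max_periodic[OF *] unfolding minimiser_def by simp
  show "action S p (\<lambda>i. min (y i) (z i)) + action S p (\<lambda>i. max (y i) (z i)) = action S p y + action S p z"
    using ** action_min_max[of p y z] by linarith
qed

text \<open>A crossing would make the action of minimum plus maximum strictly smaller. At a
  touching, strong comparison would lower the action of the minimum, which is itself a minimiser;
  \<open>p \<ge> int r + 1\<close> makes variations of a single site admissible.\<close>

lemma minimisers_ordered:
  assumes y: "minimiser p q y" and z: "minimiser p q z" and p: "p \<ge> int r + 1"
  shows "(\<forall>i. y i \<le> z i) \<or> (\<forall>i. z i \<le> y i)"
proof -
  have p1: "p \<ge> 1" using p by simp
  let ?m = "\<lambda>i. min (y i) (z i)"
  let ?M = "\<lambda>i. max (y i) (z i)"
  have crit: "(\<Sum>j\<in>{i - int r..i}. loc x j) \<le> (\<Sum>j\<in>{i - int r..i}. loc (x(i := v)) j)"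
    if "minimiser p q x" for x i v
    using coordinate_minimal[OF minimiser_locally_minimal[OF that p1]] p by simp
  have noncross: "\<not> (y j - z j) * (y (j + 1) - z (j + 1)) < 0" for j
  proof
    assume "(y j - z j) * (y (j + 1) - z (j + 1)) < 0"
    then have less: "loc ?m j + loc ?M j < loc y j + loc z j" by (rule loc_crossing(2))
    have "(\<Sum>i\<in>{j..<j + p}. loc ?m i + loc ?M i) < (\<Sum>i\<in>{j..<j + p}. loc y i + loc z i)"
      using less p by (intro sum_strict_mono_ex1) (auto intro!: loc_crossing(1) bexI[of _ j])
    moreover have "?m \<in> periodic_seqs p q" "?M \<in> periodic_seqs p q"
      using min_max_periodic y z minimiser_periodic by blast+
    ultimately have "action S p ?m + action S p ?M < action S p y + action S p z"
      using action_shift[of _ p q j] y z p minimiser_periodic by (simp add: sum.distrib)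
    then show False using min_max_minimiser(2)[OF y z] by simp
  qed
  have zero: "y (j - 1) - z (j - 1) = 0" if "y j - z j = 0" for j
  proof (rule ccontr)
    assume "y (j - 1) - z (j - 1) \<noteq> 0"
    then consider "?m (j - 1) < y (j - 1)" | "?m (j - 1) < z (j - 1)" by linarith
    then have "\<exists>v. (\<Sum>i\<in>{j - int r..j}. loc (?m(j := v)) i) < (\<Sum>i\<in>{j - int r..j}. loc ?m i)"
    proof cases
      case 1
      then show ?thesis by (intro strong_comparison[of ?m y j] crit y) (use that in auto)
    next
      case 2
      then show ?thesis by (intro strong_comparison[of ?m z j] crit z) (use that in auto)
    qed
    then show False using crit[OF min_max_minimiser(1)[OF y z]] by (meson not_less)
  qed
  consider "\<forall>j. y j - z j > 0" | "\<forall>j. y j - z j < 0" | J where "\<forall>j\<le>J. y j - z j = 0"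
    using constant_sign_or_zero[of "\<lambda>j. y j - z j", OF noncross zero] by blast
  then show ?thesis
  proof cases
    case 3
    have "y j - z j = 0" for j
    proof -
      have shift: "y (i + int n * p) - z (i + int n * p) = y i - z i" for i n
      proof (induction n)
        case (Suc n)
        have "y (i + int n * p + p) = y (i + int n * p) + of_int q" "z (i + int n * p + p) = z (i + int n * p) + of_int q"
          using y z minimiser_periodic unfolding periodic_seqs_iff by blast+
        then show ?case using Suc by (simp add: algebra_simps)
      qed simp
      \<comment> \<open>The difference of the two minimisers is \<open>p\<close>-periodic, and
        \<open>n\<close> periods to the left of \<open>j\<close> lie in the half-line of
        zeros.\<close>
      define n where "n = nat (j - J)"
      have "j - int n * p \<le> j - int n" using p by (simp add: mult_le_cancel_left1)
      then have "j - int n * p \<le> J" by (simp add: n_def split: if_splits)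
      then show ?thesis using shift[of "j - int n * p" n] 3 by simp
    qed
    then show ?thesis by (metis eq_iff_diff_eq_0 order_refl)
  qed (simp_all add: less_imp_le)
qed

text \<open>A minimiser and its translate are ordered; the direction is read off from the sum of
  their difference over a period, which is \<open>p\<close> times the height.\<close>

lemma minimiser_birkhoff:
  assumes y: "minimiser p q y" and p: "p \<ge> int r + 1"
  shows "birkhoff (of_int q / of_int p) y"
  unfolding birkhoff_def
proof (intro allI impI)
  fix k l i :: int
  define \<omega> :: real where "\<omega> = of_int q / of_int p"
  assume "of_int k * (of_int q / of_int p) + of_int l > (0 :: real)"
  then have pos: "of_int k * \<omega> + of_int l > 0" by (simp add: \<omega>_def)
  let ?z = "translate k l y"
  have z: "minimiser p q ?z" using minimiser_translate y p by simp
  \<comment> \<open>The periodic part of \<open>y\<close>: its sum over a period is unchanged by a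
    shift, so only the height remains in the sum of differences.\<close>
  define g where "g j = y j - of_int j * \<omega>" for j
  have "g (j + p) = g j" for j
    using minimiser_periodic[OF y] p unfolding periodic_seqs_iff g_def \<omega>_def by (simp add: field_simps)
  then have "sum g {k..<k + p} = sum g {0..<p}" using sum_period_shift[of g p k] p by simp
  moreover have "sum g {k..<k + p} = (\<Sum>j\<in>{0..<p}. g (j + k))"
    by (rule sum.reindex_bij_witness[of _ "\<lambda>j. j + k" "\<lambda>j. j - k"]) auto
  ultimately have "(\<Sum>j\<in>{0..<p}. g (j + k) - g j) = 0" by (simp add: sum_subtractf)
  moreover have "?z j - y j = (g (j + k) - g j) + (of_int k * \<omega> + of_int l)" for j
    by (simp add: translate_def g_def algebra_simps)
  ultimately have "(\<Sum>j\<in>{0..<p}. ?z j - y j) = of_int p * (of_int k * \<omega> + of_int l)"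
    using p by (simp add: sum.distrib)
  also have "\<dots> > 0" using p pos by simp
  finally have "\<not> (\<forall>j. ?z j \<le> y j)" using sum_nonpos[of "{0..<p}" "\<lambda>j. ?z j - y j"] by fastforce
  then show "y i \<le> y (i + k) + of_int l"
    using minimisers_ordered[OF y z p] by (auto simp: translate_def)
qed

text \<open>These are the Birkhoff minimisers of Aubry-Mather theory: no finitely supported
  variation lowers the action.\<close>

definition ground_state :: "real \<Rightarrow> (int \<Rightarrow> real) \<Rightarrow> bool" where
  "ground_state \<omega> y \<longleftrightarrow> birkhoff \<omega> y \<and> (\<forall>m. locally_minimal m y)"

lemma locally_minimal_limit:
  assumes "\<And>m. \<forall>\<^sub>F n in sequentially. locally_minimal m (y n)" "\<And>i. (\<lambda>n. y n i) \<longlonglongrightarrow> x i"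
  shows "locally_minimal m x"
  unfolding locally_minimal_def
proof (intro allI impI)
  fix z s t
  assume st: "s \<le> t" "t - s \<le> m" and z: "\<forall>i. i < s \<or> t \<le> i \<longrightarrow> z i = x i"
  \<comment> \<open>The competitor must agree with \<open>y n\<close> off the varied sites, so only
    the values of \<open>z\<close> between \<open>s\<close> and \<open>t\<close> are put into
    \<open>y n\<close>.\<close>
  define z' where "z' n i = (if i < s \<or> t \<le> i then y n i else z i)" for n i
  have z': "(\<lambda>n. z' n i) \<longlonglongrightarrow> z i" for i
    using assms(2)[of i] z unfolding z'_def by (cases "i < s \<or> t \<le> i") auto
  have "\<forall>\<^sub>F n in sequentially. (\<Sum>j\<in>{s - int r..<t}. loc (y n) j) \<le> (\<Sum>j\<in>{s - int r..<t}. loc (z' n) j)"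
    using assms(1)[of m]
  proof eventually_elim
    case (elim n)
    then show ?case using st by (intro locally_minimalD) (auto simp: z'_def)
  qed
  then show "(\<Sum>j\<in>{s - int r..<t}. loc x j) \<le> (\<Sum>j\<in>{s - int r..<t}. loc z j)"
    by (intro tendsto_le[OF _ tendsto_sum[OF loc_tendsto[OF z']] tendsto_sum[OF loc_tendsto[OF assms(2)]]]) auto
qed

lemma locally_minimal_translate:
  assumes "locally_minimal m y"
  shows "locally_minimal m (translate k l y)"
  unfolding locally_minimal_def
proof (intro allI impI)
  fix z s t
  assume st: "s \<le> t" "t - s \<le> m" and z: "\<forall>i. i < s \<or> t \<le> i \<longrightarrow> z i = translate k l y i"
  have *: "(\<Sum>j\<in>{s - int r..<t}. loc (translate k l x) j) = (\<Sum>j\<in>{s + k - int r..<t + k}. loc x j)" for x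
    unfolding loc_translate
    by (rule sum.reindex_bij_witness[of _ "\<lambda>j. j - k" "\<lambda>j. j + k"]) auto
  have zz: "z = translate k l (translate (- k) (- l) z)"
    by (simp add: fun_eq_iff translate_def)
  show "(\<Sum>j\<in>{s - int r..<t}. loc (translate k l y) j) \<le> (\<Sum>j\<in>{s - int r..<t}. loc z j)"
    unfolding * by (subst zz, subst *, rule locally_minimalD[OF assms]) (use st z in \<open>auto simp: translate_def\<close>)
qed

lemma ground_state_translate: "ground_state \<omega> y \<Longrightarrow> ground_state \<omega> (translate k l y)"
  unfolding ground_state_def by (simp add: birkhoff_translate locally_minimal_translate)

lemma ground_state_limit:
  assumes "\<And>n. ground_state \<omega> (y n)" "\<And>i. (\<lambda>n. y n i) \<longlonglongrightarrow> x i"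
  shows "ground_state \<omega> x"
  using birkhoff_limit[of "\<lambda>_. \<omega>" y \<omega> x] locally_minimal_limit[of y x] assms
  unfolding ground_state_def by simp

text \<open>As the periods grow, the admissible length \<open>p n - int r\<close> of variations
  exceeds every \<open>m\<close>. The Birkhoff property is available only once the period is larger
  than \<open>r\<close>, hence the initial segment that is dropped.\<close>

lemma minimisers_tendsto_ground_state:
  assumes "\<And>n. minimiser (p n) (q n) (y n)" "filterlim p at_top sequentially"
    "(\<lambda>n. of_int (q n) / of_int (p n)) \<longlonglongrightarrow> \<omega>" "\<And>i. (\<lambda>n. y n i) \<longlonglongrightarrow> x i"
  shows "ground_state \<omega> x"
proof -
  have ev: "\<forall>\<^sub>F n in sequentially. p n \<ge> m" for m
    using assms(2) by (simp add: filterlim_at_top)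
  obtain N where N: "\<And>n. n \<ge> N \<Longrightarrow> p n \<ge> int r + 1"
    using ev[of "int r + 1"] unfolding eventually_sequentially by blast
  have "birkhoff \<omega> x"
  proof (rule birkhoff_limit)
    show "birkhoff (of_int (q (n + N)) / of_int (p (n + N))) (y (n + N))" for n
      by (rule minimiser_birkhoff[OF assms(1) N]) simp
    show "(\<lambda>n. of_int (q (n + N)) / of_int (p (n + N))) \<longlonglongrightarrow> \<omega>"
      using LIMSEQ_ignore_initial_segment[OF assms(3)] .
    show "(\<lambda>n. y (n + N) i) \<longlonglongrightarrow> x i" for i
      using LIMSEQ_ignore_initial_segment[OF assms(4)] .
  qed
  moreover have "locally_minimal m x" for m
  proof (rule locally_minimal_limit[OF _ assms(4)])
    fix m
    show "\<forall>\<^sub>F n in sequentially. locally_minimal m (y n)"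
      using ev[of "max 1 (m + int r)"]
    proof eventually_elim
      case (elim n)
      then have "locally_minimal (p n - int r) (y n)"
        by (intro minimiser_locally_minimal[OF assms(1)]) auto
      then show ?case using elim unfolding locally_minimal_def by auto
    qed
  qed
  ultimately show ?thesis by (simp add: ground_state_def)
qed

end

section \<open>Ground states of irrational rotation number\<close>

lemma sum_le_boundary:
  fixes f g :: "'a \<Rightarrow> real"
  assumes "finite A" "finite E" "\<And>j. j \<in> A - E \<Longrightarrow> f j = g j" "\<And>j. j \<in> A \<Longrightarrow> f j \<le> g j + c" "c \<ge> 0"
  shows "sum f A \<le> sum g A + real (card E) * c"
proof -
  have "sum f A - sum g A = (\<Sum>j\<in>A. f j - g j)" by (simp add: sum_subtractf)
  also have "\<dots> = (\<Sum>j\<in>A \<inter> E. f j - g j)"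
    by (intro sum.mono_neutral_right) (use assms in auto)
  also have "\<dots> \<le> of_nat (card (A \<inter> E)) * c"
    by (intro sum_bounded_above) (use assms(4) in \<open>force simp: algebra_simps\<close>)
  also have "\<dots> \<le> real (card E) * c"
    using assms by (intro mult_right_mono) (auto intro: card_mono)
  finally show ?thesis by simp
qed

text \<open>Kronecker approximation for \<open>- \<omega>\<close> makes the multiplier of
  \<open>\<omega>\<close> negative, as needed for shifts going to the left.\<close>

lemma irrational_small_combination:
  fixes \<omega> :: real
  assumes "\<omega> \<notin> \<rat>" "\<epsilon> > 0"
  shows "\<exists>k l. k < b \<and> 0 < of_int k * \<omega> + of_int l \<and> of_int k * \<omega> + of_int l < \<epsilon>"
proof -
  \<comment> \<open>A small combination is multiplied by \<open>m\<close> to push its shift below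
    \<open>b\<close>, so it must first be smaller than \<open>\<epsilon> / m\<close>.\<close>
  define m where "m = nat \<bar>b\<bar> + 1"
  have m: "m > 0" by (simp add: m_def)
  have "- \<omega> \<notin> \<rat>" using assms(1) Rats_minus_iff by blast
  moreover have "\<epsilon> / real m > 0" using assms m by simp
  ultimately obtain k where k: "k > 0" "\<bar>frac (real k * (- \<omega>)) - 0\<bar> < \<epsilon> / real m"
    using Kronecker_approx_1_explicit[of "- \<omega>" 0] by (metis order_refl zero_le_one)
  define t where "t = frac (real k * (- \<omega>))"
  have t: "t = of_int (- int k) * \<omega> + of_int (- \<lfloor>real k * (- \<omega>)\<rfloor>)"
    by (simp add: t_def frac_def)
  have "t \<noteq> 0"
  proof
    assume "t = 0"
    then have "\<omega> = of_int (- \<lfloor>real k * (- \<omega>)\<rfloor>) / real k"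
      using t k(1) by (simp add: field_simps)
    then show False using assms(1) by (metis Rats_divide Rats_of_int Rats_of_nat)
  qed
  then have t0: "0 < t" "t < \<epsilon> / real m" using k(2) frac_ge_0[of "real k * (- \<omega>)"] by (auto simp: t_def)
  have "of_int (int m * (- int k)) * \<omega> + of_int (int m * (- \<lfloor>real k * (- \<omega>)\<rfloor>)) = real m * t"
    unfolding t by (simp add: algebra_simps)
  moreover have "0 < real m * t" "real m * t < \<epsilon>"
    using t0 m by (auto simp: field_simps)
  moreover have "int m * (- int k) < b"
  proof -
    have "int m \<le> int m * int k" using k(1) by (simp add: mult_le_cancel_left1)
    then show ?thesis by (simp add: m_def)
  qed
  ultimately show ?thesis by metis
qed

lemma irrational_combination_sequence:
  fixes \<omega> :: real
  assumes "\<omega> \<notin> \<rat>"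
  obtains k l :: "nat \<Rightarrow> int" where "\<And>n. of_int (k n) * \<omega> + of_int (l n) > 0"
    "(\<lambda>n. of_int (k n) * \<omega> + of_int (l n)) \<longlonglongrightarrow> 0" "filterlim k at_bot sequentially"
proof -
  have "\<exists>k l. k < - int n \<and> 0 < of_int k * \<omega> + of_int l \<and> of_int k * \<omega> + of_int l < inverse (real (Suc n))" for n
    using irrational_small_combination[OF assms, of "inverse (real (Suc n))"] by simp
  then obtain k l :: "nat \<Rightarrow> int" where *: "\<And>n. k n < - int n" "\<And>n. 0 < of_int (k n) * \<omega> + of_int (l n)"
    "\<And>n. of_int (k n) * \<omega> + of_int (l n) < inverse (real (Suc n))" by metis
  have "(\<lambda>n. of_int (k n) * \<omega> + of_int (l n)) \<longlonglongrightarrow> 0"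
    by (rule tendsto_sandwich[OF _ _ tendsto_const LIMSEQ_inverse_real_of_nat])
       (use * in \<open>auto intro!: always_eventually less_imp_le\<close>)
  moreover have "filterlim k at_bot sequentially"
    unfolding filterlim_at_bot
  proof
    fix Z
    show "\<forall>\<^sub>F n in sequentially. k n \<le> Z"
      unfolding eventually_sequentially
    proof (intro exI[of _ "nat (- Z)"] allI impI)
      fix n assume "nat (- Z) \<le> n"
      then show "k n \<le> Z" using *(1)[of n] by linarith
    qed
  qed
  ultimately show thesis using that *(2) by blast
qed

text \<open>Translates increase with their height, so this infimum is the limit of the translates as
  the height decreases to 0: the value from the right of the monotone hull function.\<close>

definition right_limit :: "real \<Rightarrow> (int \<Rightarrow> real) \<Rightarrow> int \<Rightarrow> real" where
  "right_limit \<omega> y i = Inf {translate k l y i | k l. of_int k * \<omega> + of_int l > 0}"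

lemma right_limit_bounds:
  assumes "birkhoff \<omega> y"
  shows "y i \<le> right_limit \<omega> y i"
    and "of_int k * \<omega> + of_int l > 0 \<Longrightarrow> right_limit \<omega> y i \<le> translate k l y i"
proof -
  have *: "y i \<le> translate k l y i" if "of_int k * \<omega> + of_int l > 0" for k l
    using birkhoff_le[OF assms that] by (simp add: translate_def)
  have "of_int 0 * \<omega> + of_int 1 > 0" by simp
  then show "y i \<le> right_limit \<omega> y i"
    unfolding right_limit_def by (intro cInf_greatest) (use * in blast)+
  show "right_limit \<omega> y i \<le> translate k l y i" if "of_int k * \<omega> + of_int l > 0"
    unfolding right_limit_def
    by (rule cInf_lower) (use that * in \<open>auto simp: bdd_below_def\<close>)
qed

text \<open>By monotonicity in the height, any positive heights tending to 0 realise the infimum.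
  One sequence of translations thus serves all ground states of rotation number
  \<open>\<omega>\<close>.\<close>

lemma right_limit_tendsto:
  assumes y: "birkhoff \<omega> y" and pos: "\<And>n. of_int (k n) * \<omega> + of_int (l n) > 0"
    and lim: "(\<lambda>n. of_int (k n) * \<omega> + of_int (l n)) \<longlonglongrightarrow> 0"
  shows "(\<lambda>n. translate (k n) (l n) y i) \<longlonglongrightarrow> right_limit \<omega> y i"
proof (rule LIMSEQ_I)
  fix e :: real
  assume e: "e > 0"
  have "\<exists>w\<in>{translate k l y i | k l. of_int k * \<omega> + of_int l > 0}. w < right_limit \<omega> y i + e"
  proof (rule cInf_lessD)
    have "of_int 0 * \<omega> + of_int 1 > 0" by simp
    then show "{translate k l y i | k l. of_int k * \<omega> + of_int l > 0} \<noteq> {}" by blast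
  qed (use e in \<open>simp add: right_limit_def\<close>)
  then obtain k' l' where kl: "of_int k' * \<omega> + of_int l' > 0" "translate k' l' y i < right_limit \<omega> y i + e"
    by blast
  obtain N where N: "\<And>n. n \<ge> N \<Longrightarrow> of_int (k n) * \<omega> + of_int (l n) < of_int k' * \<omega> + of_int l'"
    using order_tendstoD(2)[OF lim kl(1)] unfolding eventually_sequentially by blast
  have "norm (translate (k n) (l n) y i - right_limit \<omega> y i) < e" if "n \<ge> N" for n
    using birkhoff_translate_mono[OF y N[OF that], of i] kl(2) right_limit_bounds(2)[OF y pos[of n], of i]
    by simp
  then show "\<exists>N. \<forall>n\<ge>N. norm (translate (k n) (l n) y i - right_limit \<omega> y i) < e" by blast
qed

text \<open>The translations are parameters so that two sequences can be required to recur
  simultaneously; only then does a crossing of the two recur.\<close>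

definition recurrent :: "(nat \<Rightarrow> int) \<Rightarrow> (nat \<Rightarrow> int) \<Rightarrow> (int \<Rightarrow> real) \<Rightarrow> bool" where
  "recurrent k l y \<longleftrightarrow> (\<forall>i. (\<lambda>n. translate (k n) (l n) y i) \<longlonglongrightarrow> y i)"

lemma recurrent_translate: 
  assumes "recurrent k l y"
  shows "recurrent k l (translate a b y)"
  unfolding recurrent_def
proof
  fix i
  have "(\<lambda>n. translate (k n) (l n) y (i + a) + of_int b) \<longlonglongrightarrow> y (i + a) + of_int b"
    using assms unfolding recurrent_def by (intro tendsto_intros) blast
  then show "(\<lambda>n. translate (k n) (l n) (translate a b y) i) \<longlonglongrightarrow> translate a b y i"
    by (simp add: translate_def add_ac)
qed

section \<open>Recurrent ground states do not cross\<close>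

context local_potential
begin

lemma ground_state_birkhoff: "ground_state \<omega> y \<Longrightarrow> birkhoff \<omega> y"
  and ground_state_locally_minimal: "ground_state \<omega> y \<Longrightarrow> locally_minimal m y"
  by (simp_all add: ground_state_def)

lemma right_limit_recurrent:
  assumes y: "ground_state \<omega> y" and pos: "\<And>n. of_int (k n) * \<omega> + of_int (l n) > 0"
    and lim: "(\<lambda>n. of_int (k n) * \<omega> + of_int (l n)) \<longlonglongrightarrow> 0"
  shows "ground_state \<omega> (right_limit \<omega> y)" and "recurrent k l (right_limit \<omega> y)"
proof -
  have b: "birkhoff \<omega> y" using y by (rule ground_state_birkhoff)
  show *: "ground_state \<omega> (right_limit \<omega> y)"
    by (rule ground_state_limit[OF ground_state_translate[OF y] right_limit_tendsto[OF b pos lim]])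
  show "recurrent k l (right_limit \<omega> y)"
    unfolding recurrent_def
  proof
    fix i
    \<comment> \<open>Doubled translations also have positive heights tending to 0. Translating the
      bound of the right limit by \<open>translate (k n) (l n) y\<close> once more gives the upper
      sequence of the sandwich.\<close>
    have two: "of_int (2 * k n) * \<omega> + of_int (2 * l n) = 2 * (of_int (k n) * \<omega> + of_int (l n))" for n
      by (simp add: algebra_simps)
    have lim2: "(\<lambda>n. translate (2 * k n) (2 * l n) y i) \<longlonglongrightarrow> right_limit \<omega> y i"
    proof (rule right_limit_tendsto[OF b])
      show "of_int (2 * k n) * \<omega> + of_int (2 * l n) > 0" for n
        unfolding two using pos[of n] by simp
      show "(\<lambda>n. of_int (2 * k n) * \<omega> + of_int (2 * l n)) \<longlonglongrightarrow> 0"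
        unfolding two using tendsto_mult_right_zero[OF lim, of 2] by simp
    qed
    show "(\<lambda>n. translate (k n) (l n) (right_limit \<omega> y) i) \<longlonglongrightarrow> right_limit \<omega> y i"
    proof (rule tendsto_sandwich[OF _ _ tendsto_const lim2])
      show "\<forall>\<^sub>F n in sequentially. right_limit \<omega> y i \<le> translate (k n) (l n) (right_limit \<omega> y) i"
        using birkhoff_le[OF ground_state_birkhoff[OF *] pos] by (simp add: translate_def)
      have "translate (k n) (l n) (right_limit \<omega> y) i \<le> translate (2 * k n) (2 * l n) y i" for n
        using right_limit_bounds(2)[OF b pos[of n], of "i + k n"] by (simp add: translate_def add_ac)
      then show "\<forall>\<^sub>F n in sequentially. translate (k n) (l n) (right_limit \<omega> y) i \<le> translate (2 * k n) (2 * l n) y i"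
        by simp
    qed
  qed
qed

text \<open>The action gained near site \<open>i\<close> by passing to the minimum, shifted by \<open>e\<close> at \<open>i\<close>, and the maximum.\<close>

definition gain :: "(int \<Rightarrow> real) \<Rightarrow> (int \<Rightarrow> real) \<Rightarrow> int \<Rightarrow> real \<Rightarrow> real" where
  "gain y z i e = (\<Sum>j\<in>{i - int r..i}. loc y j + loc z j
     - loc ((\<lambda>a. min (y a) (z a))(i := min (y i) (z i) + e)) j - loc (\<lambda>a. max (y a) (z a)) j)"

lemma gain_translate: "gain (translate k l y) (translate k l z) i e = gain y z (i + k) e"
proof -
  have 1: "(\<lambda>a. min (translate k l y a) (translate k l z a))(i := min (translate k l y i) (translate k l z i) + e)
      = translate k l ((\<lambda>a. min (y a) (z a))(i + k := min (y (i + k)) (z (i + k)) + e))"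
    by (auto simp: fun_eq_iff translate_def)
  have 2: "(\<lambda>a. max (translate k l y a) (translate k l z a)) = translate k l (\<lambda>a. max (y a) (z a))"
    by (auto simp: fun_eq_iff translate_def)
  show ?thesis unfolding gain_def 1 2 loc_translate
    by (rule sum.reindex_bij_witness[of _ "\<lambda>j. j - k" "\<lambda>j. j + k"]) auto
qed

lemma gain_tendsto:
  assumes "\<And>i. (\<lambda>n. y n i) \<longlonglongrightarrow> y' i" "\<And>i. (\<lambda>n. z n i) \<longlonglongrightarrow> z' i"
  shows "(\<lambda>n. gain (y n) (z n) i e) \<longlonglongrightarrow> gain y' z' i e"
proof -
  have "(\<lambda>n. ((\<lambda>a. min (y n a) (z n a))(i := min (y n i) (z n i) + e)) a) \<longlonglongrightarrow>
      ((\<lambda>a. min (y' a) (z' a))(i := min (y' i) (z' i) + e)) a" for a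
    by (cases "a = i") (auto intro!: tendsto_intros assms)
  then show ?thesis unfolding gain_def
    by (intro tendsto_sum tendsto_diff tendsto_add loc_tendsto tendsto_max assms)
qed

text \<open>A positive gain would reappear, at least half as large, at sites arbitrarily far to the
  left. Exploiting \<open>N\<close> such sites saves an amount proportional to \<open>N\<close>,
  while exchanging \<open>y\<close> and \<open>z\<close> for the improved minimum and the maximum on
  an interval costs a bounded amount at its ends. The cases \<open>e = 0\<close> and
  \<open>e \<noteq> 0\<close> serve crossings and touchings.\<close>

lemma no_recurrent_gain:
  assumes y: "ground_state \<omega> y" "recurrent k l y" and z: "ground_state \<omega> z" "recurrent k l z"
    and k: "filterlim k at_bot sequentially"
  shows "gain y z i e \<le> 0"
proof (rule ccontr)
  assume "\<not> gain y z i e \<le> 0"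
  define \<gamma> where "\<gamma> = gain y z i e"
  have \<gamma>: "\<gamma> > 0" using \<open>\<not> _\<close> by (simp add: \<gamma>_def)
  define m where "m = (\<lambda>a. min (y a) (z a))"
  define M where "M = (\<lambda>a. max (y a) (z a))"
  have far: "\<exists>t<b. gain y z t e \<ge> \<gamma> / 2" for b
  proof -
    have "(\<lambda>n. gain (translate (k n) (l n) y) (translate (k n) (l n) z) i e) \<longlonglongrightarrow> \<gamma>"
      unfolding \<gamma>_def using y(2) z(2) unfolding recurrent_def by (intro gain_tendsto) auto
    then have "\<forall>\<^sub>F n in sequentially. \<gamma> / 2 < gain y z (i + k n) e"
      unfolding gain_translate by (rule order_tendstoD) (use \<gamma> in simp)
    moreover have "\<forall>\<^sub>F n in sequentially. k n \<le> b - i - 1"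
      using k unfolding filterlim_at_bot by blast
    ultimately have "\<forall>\<^sub>F n in sequentially. \<gamma> / 2 < gain y z (i + k n) e \<and> i + k n < b"
      by eventually_elim auto
    then obtain n where "\<gamma> / 2 < gain y z (i + k n) e" "i + k n < b"
      using eventually_happens' sequentially_bot by blast
    then show ?thesis by (intro exI[of _ "i + k n"]) simp
  qed
  have cross: "loc y j + loc z j - loc m j - loc M j \<ge> 0" for j
    using loc_crossing(1)[of y z j] unfolding m_def M_def by simp
  \<comment> \<open>Here \<open>u\<close> is the minimum altered by \<open>e\<close> at
    \<open>N\<close> sites so far apart that their gains add up.\<close>
  have build: "\<exists>lo hi u. lo \<le> hi \<and> (\<forall>i. i < lo \<or> hi \<le> i \<longrightarrow> u i = m i) \<and> (\<forall>i. \<bar>u i - m i\<bar> \<le> \<bar>e\<bar>) \<and>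
      real N * (\<gamma> / 2) \<le> (\<Sum>j\<in>{lo - int r..<hi}. loc y j + loc z j - loc u j - loc M j)" for N
  proof (induction N)
    case 0
    show ?case using cross by (intro exI[of _ 0] exI[of _ m]) (auto intro!: sum_nonneg)
  next
    case (Suc N)
    then obtain lo hi u where u: "lo \<le> hi" "\<And>i. i < lo \<or> hi \<le> i \<Longrightarrow> u i = m i" "\<And>i. \<bar>u i - m i\<bar> \<le> \<bar>e\<bar>"
      "real N * (\<gamma> / 2) \<le> (\<Sum>j\<in>{lo - int r..<hi}. loc y j + loc z j - loc u j - loc M j)" by blast
    \<comment> \<open>No window contains both \<open>t\<close> and a site from \<open>lo\<close> on,
      so the new gain is not disturbed by the earlier alterations.\<close>
    obtain t where t: "t < lo - int r - int r" "gain y z t e \<ge> \<gamma> / 2" using far by blast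
    define u' where "u' = u(t := m t + e)"
    let ?f = "\<lambda>j. loc y j + loc z j - loc u' j - loc M j"
    have "{t - int r..<t + 1} = {t - int r..t}" by auto
    moreover have "loc u' j = loc (m(t := m t + e)) j" if "j \<in> {t - int r..t}" for j
      using that t(1) u(2) by (intro loc_cong) (auto simp: u'_def)
    ultimately have 1: "sum ?f {t - int r..<t + 1} \<ge> \<gamma> / 2"
      using t(2) by (simp add: gain_def m_def M_def)
    have "loc u' j = loc m j" if "j \<in> {t + 1..<lo - int r}" for j
      using that u(2) by (intro loc_cong) (auto simp: u'_def)
    then have 2: "sum ?f {t + 1..<lo - int r} \<ge> 0"
      using cross by (intro sum_nonneg) simp
    have "loc u' j = loc u j" if "j \<in> {lo - int r..<hi}" for j
      using that t(1) by (intro loc_cong) (auto simp: u'_def)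
    then have 3: "sum ?f {lo - int r..<hi} \<ge> real N * (\<gamma> / 2)"
      using u(4) by simp
    have "sum ?f {t - int r..<hi} = sum ?f {t - int r..<t + 1} + sum ?f {t + 1..<hi}"
      by (rule sum_int_split) (use t(1) u(1) in auto)
    also have "sum ?f {t + 1..<hi} = sum ?f {t + 1..<lo - int r} + sum ?f {lo - int r..<hi}"
      by (rule sum_int_split) (use t(1) u(1) in auto)
    finally have "sum ?f {t - int r..<hi} \<ge> real (Suc N) * (\<gamma> / 2)"
      using 1 2 3 by (simp add: algebra_simps)
    moreover have "\<forall>i. i < t \<or> hi \<le> i \<longrightarrow> u' i = m i" "\<forall>i. \<bar>u' i - m i\<bar> \<le> \<bar>e\<bar>" "t \<le> hi"
      using u(1-3) t(1) by (auto simp: u'_def)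
    ultimately show ?case by blast
  qed
  \<comment> \<open>Each of \<open>y\<close> and \<open>z\<close> deviates from linear growth of
    slope \<open>\<omega>\<close> by at most 2, so they stay within
    \<open>\<bar>y 0 - z 0\<bar> + 4\<close> of each other; the last summand allows for the
    alterations.\<close>
  define D where "D = \<bar>y 0 - z 0\<bar> + 4 + \<bar>e\<bar>"
  have yz: "\<bar>y i - z i\<bar> \<le> D - \<bar>e\<bar>" for i
    using birkhoff_deviation[OF ground_state_birkhoff[OF y(1)], of 0 i]
      birkhoff_deviation[OF ground_state_birkhoff[OF z(1)], of 0 i] by (simp add: D_def)
  define K where "K = real r * \<bar>\<omega>\<bar> + 2 + 2 * D"
  have tame: "tame K x" if "\<And>i. \<bar>x i - w i\<bar> \<le> D" "ground_state \<omega> w" for x w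
    unfolding tame_def
  proof (intro allI impI)
    fix i j :: int
    assume "\<bar>i - j\<bar> \<le> int r"
    then have "\<bar>w i - w j\<bar> \<le> real r * \<bar>\<omega>\<bar> + 2"
      using birkhoff_tame[OF ground_state_birkhoff[OF that(2)]] unfolding tame_def by blast
    then show "\<bar>x i - x j\<bar> \<le> K" using that(1)[of i] that(1)[of j] by (simp add: K_def)
  qed
  obtain B0 where B0: "\<And>x j. tame K x \<Longrightarrow> \<bar>loc x j\<bar> \<le> B0" using loc_bounded by metis
  define B where "B = max 0 B0"
  have B: "\<bar>loc x j\<bar> \<le> B" if "tame K x" for x j using B0[OF that, of j] by (simp add: B_def)
  \<comment> \<open>Since \<open>u\<close> need not meet \<open>w\<close> at the ends, local
    minimality is applied to the spliced sequence \<open>x\<close>. It differs from \<open>u\<close>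
    in at most \<open>2 * r\<close> windows, each costing at most \<open>2 * B\<close>.\<close>
  have replace: "(\<Sum>j\<in>{lo - int r..<hi}. loc w j) \<le> (\<Sum>j\<in>{lo - int r..<hi}. loc u j) + 4 * real r * B"
    if lohi: "lo \<le> hi" and u: "\<And>i. \<bar>u i - w i\<bar> \<le> D" and w: "ground_state \<omega> w" for lo hi u w
  proof -
    have D: "D \<ge> 0" by (simp add: D_def)
    define x where "x i = (if i < lo \<or> hi \<le> i then w i else u i)" for i
    have x: "\<bar>x i - w i\<bar> \<le> D" for i using u D by (simp add: x_def)
    have "(\<Sum>j\<in>{lo - int r..<hi}. loc w j) \<le> (\<Sum>j\<in>{lo - int r..<hi}. loc x j)"
      by (rule locally_minimalD[OF ground_state_locally_minimal[OF w] lohi order_refl]) (auto simp: x_def)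
    also have "\<dots> \<le> (\<Sum>j\<in>{lo - int r..<hi}. loc u j)
        + real (card ({lo - int r..<lo} \<union> {hi - int r..<hi})) * (2 * B)"
    proof (rule sum_le_boundary)
      show "loc x j = loc u j" if "j \<in> {lo - int r..<hi} - ({lo - int r..<lo} \<union> {hi - int r..<hi})" for j
        using that by (intro loc_cong) (auto simp: x_def)
      show "loc x j \<le> loc u j + 2 * B" for j
        using B[OF tame[OF x w], of j] B[OF tame[OF u w], of j] by linarith
      show "0 \<le> 2 * B" by (simp add: B_def)
    qed auto
    also have "\<dots> \<le> (\<Sum>j\<in>{lo - int r..<hi}. loc u j) + (2 * real r) * (2 * B)"
    proof -
      have "card ({lo - int r..<lo} \<union> {hi - int r..<hi}) \<le> 2 * r"
        using card_Un_le[of "{lo - int r..<lo}" "{hi - int r..<hi}"] by simp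
      then have "real (card ({lo - int r..<lo} \<union> {hi - int r..<hi})) \<le> 2 * real r" by linarith
      then show ?thesis by (intro add_left_mono mult_right_mono) (auto simp: B_def)
    qed
    finally show ?thesis by simp
  qed
  have "real N * (\<gamma> / 2) \<le> 8 * real r * B" for N
  proof -
    obtain lo hi u where u: "lo \<le> hi" "\<And>i. \<bar>u i - m i\<bar> \<le> \<bar>e\<bar>"
      "real N * (\<gamma> / 2) \<le> (\<Sum>j\<in>{lo - int r..<hi}. loc y j + loc z j - loc u j - loc M j)" using build[of N] by blast
    have "\<bar>u i - y i\<bar> \<le> D" "\<bar>M i - z i\<bar> \<le> D" for i
      using u(2)[of i] yz[of i] by (auto simp: m_def M_def min_def max_def split: if_splits)
    from replace[OF u(1) this(1) y(1)] replace[OF u(1) this(2) z(1)] u(3)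
    show ?thesis by (simp add: sum.distrib sum_subtractf)
  qed
  moreover obtain N where "8 * real r * B / (\<gamma> / 2) < real N" using reals_Archimedean2 by blast
  then have "8 * real r * B < real N * (\<gamma> / 2)" using \<gamma> by (simp add: field_simps)
  ultimately show False using not_less by blast
qed

text \<open>The counterpart of the periodic ordering argument, with the absence of gains replacing
  minimality of the total action, which is infinite in extent here. The order at site 0 decides the
  direction.\<close>

lemma recurrent_ground_states_ordered:
  assumes y: "ground_state \<omega> y" "recurrent k l y" and z: "ground_state \<omega> z" "recurrent k l z"
    and k: "filterlim k at_bot sequentially" and le: "y 0 \<le> z 0"
  shows "y i \<le> z i"
proof -
  let ?m = "\<lambda>i. min (y i) (z i)"
  let ?M = "\<lambda>i. max (y i) (z i)"
  have gain: "gain y z j e \<le> 0" for j e by (rule no_recurrent_gain[OF y z k])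
  have cross: "loc ?m j + loc ?M j \<le> loc y j + loc z j" for j by (rule loc_crossing(1))
  have crit: "(\<Sum>j\<in>{i - int r..i}. loc x j) \<le> (\<Sum>j\<in>{i - int r..i}. loc (x(i := v)) j)"
    if "ground_state \<omega> x" for x i v
    using coordinate_minimal[OF ground_state_locally_minimal[OF that, of 1]] by simp
  have noncross: "\<not> (y j - z j) * (y (j + 1) - z (j + 1)) < 0" for j
  proof
    assume "(y j - z j) * (y (j + 1) - z (j + 1)) < 0"
    then have less: "loc ?m j + loc ?M j < loc y j + loc z j" by (rule loc_crossing(2))
    have "(\<Sum>i\<in>{j - int r..j}. loc ?m i + loc ?M i) < (\<Sum>i\<in>{j - int r..j}. loc y i + loc z i)"
      using less by (intro sum_strict_mono_ex1) (auto intro!: cross bexI[of _ j])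
    moreover have "?m(j := ?m j + 0) = ?m" by (simp add: fun_upd_idem)
    ultimately have "gain y z j 0 > 0"
      unfolding gain_def by (simp add: sum.distrib sum_subtractf)
    then show False using gain[of j 0] by simp
  qed
  have zero: "y (j - 1) - z (j - 1) = 0" if "y j - z j = 0" for j
  proof (rule ccontr)
    assume "y (j - 1) - z (j - 1) \<noteq> 0"
    then consider "?m (j - 1) < y (j - 1)" | "?m (j - 1) < z (j - 1)" by linarith
    then have "\<exists>v. (\<Sum>i\<in>{j - int r..j}. loc (?m(j := v)) i) < (\<Sum>i\<in>{j - int r..j}. loc ?m i)"
    proof cases
      case 1
      then show ?thesis by (intro strong_comparison[of ?m y j] crit y) (use that in auto)
    next
      case 2
      then show ?thesis by (intro strong_comparison[of ?m z j] crit z) (use that in auto)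
    qed
    then obtain v where v: "(\<Sum>i\<in>{j - int r..j}. loc (?m(j := v)) i) < (\<Sum>i\<in>{j - int r..j}. loc ?m i)" ..
    have "(\<Sum>i\<in>{j - int r..j}. loc ?m i + loc ?M i) \<le> (\<Sum>i\<in>{j - int r..j}. loc y i + loc z i)"
      by (intro sum_mono cross)
    \<comment> \<open>The shift \<open>e\<close> moves the minimum at \<open>j\<close> to the value
      \<open>v\<close> supplied by strong comparison.\<close>
    then have "gain y z j (v - ?m j) > 0"
      using v unfolding gain_def by (simp add: sum.distrib sum_subtractf)
    then show False using gain[of j "v - ?m j"] by simp
  qed
  consider "\<forall>j. y j - z j > 0" | "\<forall>j. y j - z j < 0" | J where "\<forall>j\<le>J. y j - z j = 0"
    using constant_sign_or_zero[of "\<lambda>j. y j - z j", OF noncross zero] by blast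
  then show ?thesis
  proof cases
    case 1
    then have "y 0 - z 0 > 0" by blast
    then show ?thesis using le by simp
  next
    case 2
    then have "y i - z i < 0" by blast
    then show ?thesis by simp
  next
    \<comment> \<open>Recurrence along shifts to the left carries coincidence on the left half-line
      to every site.\<close>
    case 3
    have "\<forall>\<^sub>F n in sequentially. k n \<le> J - i"
      using k unfolding filterlim_at_bot by blast
    then have ev: "\<forall>\<^sub>F n in sequentially. translate (k n) (l n) y i = translate (k n) (l n) z i"
      by eventually_elim (use 3 in \<open>simp add: translate_def\<close>)
    have lim: "(\<lambda>n. translate (k n) (l n) y i) \<longlonglongrightarrow> y i" "(\<lambda>n. translate (k n) (l n) z i) \<longlonglongrightarrow> z i"
      using y z by (auto simp: recurrent_def)
    have "y i = z i"
      by (rule LIMSEQ_unique[OF Lim_transform_eventually[OF lim(1) ev] lim(2)])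
    then show ?thesis by simp
  qed
qed

text \<open>The order holds for the right limits after lowering that of \<open>y\<close> by one
  translate, which puts it below \<open>y\<close> at site 0. Returning from the right limit of
  \<open>z\<close> to \<open>z\<close> costs a translate upwards.\<close>

lemma ground_states_almost_ordered:
  assumes "\<omega> \<notin> \<rat>" and y: "ground_state \<omega> y" and z: "ground_state \<omega> z" and le: "y 0 \<le> z 0"
    and s: "of_int k * \<omega> + of_int l > 0"
  shows "translate (- k) (- l) y i \<le> translate k l z i"
proof -
  obtain k' l' :: "nat \<Rightarrow> int" where kl: "\<And>n. of_int (k' n) * \<omega> + of_int (l' n) > 0"
    "(\<lambda>n. of_int (k' n) * \<omega> + of_int (l' n)) \<longlonglongrightarrow> 0" "filterlim k' at_bot sequentially"
    using irrational_combination_sequence[OF assms(1)] by metis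
  note b = ground_state_birkhoff[OF y] ground_state_birkhoff[OF z]
  let ?y = "translate (- k) (- l) (right_limit \<omega> y)"
  have "?y i \<le> right_limit \<omega> z i"
  proof (rule recurrent_ground_states_ordered[OF _ _ _ _ kl(3)])
    show "ground_state \<omega> ?y" "recurrent k' l' ?y"
      using right_limit_recurrent[OF y kl(1,2)] ground_state_translate recurrent_translate by blast+
    show "ground_state \<omega> (right_limit \<omega> z)" "recurrent k' l' (right_limit \<omega> z)"
      using right_limit_recurrent[OF z kl(1,2)] by blast+
    have "?y 0 \<le> y 0" using right_limit_bounds(2)[OF b(1) s, of "- k"] by (simp add: translate_def)
    then show "?y 0 \<le> right_limit \<omega> z 0" using le right_limit_bounds(1)[OF b(2), of 0] by linarith
  qed
  moreover have "translate (- k) (- l) y i \<le> ?y i"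
    using right_limit_bounds(1)[OF b(1), of "i - k"] by (simp add: translate_def)
  moreover have "right_limit \<omega> z i \<le> translate k l z i"
    using right_limit_bounds(2)[OF b(2) s] .
  ultimately show ?thesis by linarith
qed

end

section \<open>Transplanting constrained minimisers\<close>

text \<open>Fractions with a fixed denominator form a discrete set missing \<open>\<omega>\<close>;
  the induction excludes one denominator at a time.\<close>

lemma irrational_denominator_large:
  fixes \<omega> :: real
  assumes "\<omega> \<notin> \<rat>"
  shows "\<exists>\<delta>>0. \<forall>(q::int) (p::int). 1 \<le> p \<longrightarrow> \<bar>of_int q / of_int p - \<omega>\<bar> < \<delta> \<longrightarrow> p > int N"
proof (induction N)
  case 0
  show ?case by (intro exI[of _ 1]) auto
next
  case (Suc N)
  then obtain \<delta> where \<delta>: "\<delta> > 0"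
    "\<And>(q::int) (p::int). 1 \<le> p \<Longrightarrow> \<bar>of_int q / of_int p - \<omega>\<bar> < \<delta> \<Longrightarrow> p > int N" by blast
  define t where "t = of_int (int (Suc N)) * \<omega>"
  have "\<omega> = t / of_int (int (Suc N))" by (simp add: t_def)
  then have "t \<notin> \<int>" using assms by (metis Ints_cases Rats_divide Rats_of_int)
  then have fr: "0 < frac t" "frac t < 1" using frac_lt_1 by auto
  \<comment> \<open>The second bound is the distance from \<open>\<omega>\<close> to the fractions
    with denominator \<open>Suc N\<close>.\<close>
  define \<delta>' where "\<delta>' = min \<delta> (min (frac t) (1 - frac t) / real (Suc N))"
  have "\<delta>' > 0" using fr \<delta>(1) by (simp add: \<delta>'_def)
  moreover have "p > int (Suc N)" if p: "1 \<le> p" and close: "\<bar>of_int q / of_int p - \<omega>\<bar> < \<delta>'" for q p :: int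
  proof (rule ccontr)
    assume "\<not> ?thesis"
    moreover have "p > int N" using \<delta>(2)[OF p, of q] close by (simp add: \<delta>'_def)
    ultimately have pN: "p = int (Suc N)" by simp
    have "\<bar>of_int q / of_int p - \<omega>\<bar> < min (frac t) (1 - frac t) / real (Suc N)"
      using close by (simp add: \<delta>'_def)
    moreover have "of_int q / of_int p - \<omega> = (of_int q - t) / real (Suc N)"
      unfolding pN t_def by (simp add: diff_divide_distrib)
    ultimately have "\<bar>of_int q - t\<bar> < min (frac t) (1 - frac t)"
      by (simp add: divide_less_cancel)
    then have "of_int \<lfloor>t\<rfloor> < (of_int q :: real)" "(of_int q :: real) < of_int (\<lfloor>t\<rfloor> + 1)"
      unfolding frac_def of_int_add of_int_1 by linarith+
    then show False unfolding of_int_less_iff by linarith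
  qed
  ultimately show ?case by blast
qed

text \<open>The two sums share all but \<open>\<kappa>\<close> terms at each end. What remains are
  \<open>\<kappa>\<close> differences over distance \<open>L\<close>, each controlled by the
  rotation number.\<close>

lemma birkhoff_telescope:
  assumes y: "birkhoff \<omega> y" and \<kappa>: "\<kappa> \<ge> 0" and L: "L \<ge> 0"
  shows "(\<Sum>i\<in>{b..<b + L}. y (i - \<kappa>) - y i) \<le> of_int \<kappa> * (2 - of_int L * \<omega>)"
proof -
  have "(\<Sum>i\<in>{b..<b + L}. y (i - \<kappa>)) = sum y {b - \<kappa>..<b - \<kappa> + L}"
    by (rule sum.reindex_bij_witness[of _ "\<lambda>i. i + \<kappa>" "\<lambda>i. i - \<kappa>"]) auto
  moreover have "sum y {b - \<kappa>..<b + L} = sum y {b - \<kappa>..<b} + sum y {b..<b + L}"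
    by (rule sum_int_split) (use \<kappa> L in auto)
  moreover have "sum y {b - \<kappa>..<b + L} = sum y {b - \<kappa>..<b - \<kappa> + L} + sum y {b - \<kappa> + L..<b + L}"
    by (rule sum_int_split) (use \<kappa> L in auto)
  moreover have "sum y {b - \<kappa> + L..<b + L} = (\<Sum>i\<in>{b - \<kappa>..<b}. y (i + L))"
    by (rule sum.reindex_bij_witness[of _ "\<lambda>i. i + L" "\<lambda>i. i - L"]) auto
  ultimately have "(\<Sum>i\<in>{b..<b + L}. y (i - \<kappa>) - y i) = (\<Sum>i\<in>{b - \<kappa>..<b}. y i - y (i + L))"
    by (simp add: sum_subtractf)
  also have "\<dots> \<le> (\<Sum>i\<in>{b - \<kappa>..<b}. 2 - of_int L * \<omega>)"
  proof (rule sum_mono)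
    fix i
    show "y i - y (i + L) \<le> 2 - of_int L * \<omega>"
      using birkhoff_deviation[OF y, of i L] by linarith
  qed
  also have "\<dots> = of_int \<kappa> * (2 - of_int L * \<omega>)" using \<kappa> by simp
  finally show ?thesis .
qed

lemma sum_blocks:
  fixes f :: "int \<Rightarrow> real"
  assumes "\<And>i. f i \<ge> 0" and "\<And>j. b \<le> j \<Longrightarrow> j + int r \<le> b + int (r * N) \<Longrightarrow> \<exists>i. j \<le> i \<and> i < j + int r \<and> f i \<ge> \<eta>"
  shows "sum f {b..<b + int (r * N)} \<ge> real N * \<eta>"
  using assms(2)
proof (induction N)
  case (Suc N)
  have "\<exists>i. b + int (r * N) \<le> i \<and> i < b + int (r * N) + int r \<and> f i \<ge> \<eta>"
    by (rule Suc.prems) auto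
  then obtain i where i: "b + int (r * N) \<le> i" "i < b + int (r * N) + int r" "f i \<ge> \<eta>" by blast
  have "f i \<le> sum f {b + int (r * N)..<b + int (r * N) + int r}"
    by (rule member_le_sum) (use i assms(1) in auto)
  moreover have "real N * \<eta> \<le> sum f {b..<b + int (r * N)}"
    by (rule Suc.IH) (use Suc.prems in auto)
  moreover have "sum f {b..<b + int (r * Suc N)} = sum f {b..<b + int (r * N)} + sum f {b + int (r * N)..<b + int (r * Suc N)}"
    by (rule sum_int_split) auto
  moreover have "b + int (r * Suc N) = b + int (r * N) + int r" by simp
  ultimately show ?case using i(3) by (simp add: algebra_simps)
qed simp

lemma int_crossing:
  fixes P :: "int \<Rightarrow> bool"
  assumes "P a" "\<not> P b" "a \<le> b"
  shows "\<exists>N. P N \<and> \<not> P (N + 1)"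
proof (rule ccontr)
  assume no: "\<not> ?thesis"
  have "P n" if "a \<le> n" for n
    using that by (induction n rule: int_ge_induct) (use assms(1) no in auto)
  then show False using assms(2,3) by blast
qed

lemma Least_image_minimiser:
  assumes "y \<in> A" "\<And>x. x \<in> A \<Longrightarrow> f y \<le> (f x :: real)"
  shows "(LEAST w. w \<in> f ` A) = f y"
  by (rule Least_equality) (use assms in auto)

section \<open>Thin windows, gluing and rational barriers\<close>

context local_potential
begin

text \<open>By telescoping, the band between \<open>a\<close> and its translate has width about
  \<open>s\<close> per site on average. If every \<open>r\<close> consecutive sites had one of width
  at least \<open>\<eta>\<close>, the average would be at least \<open>\<eta> / r\<close>, contrary
  to \<open>small\<close>.\<close>

lemma close_windows:
  assumes a: "birkhoff \<omega> a" and k: "k \<le> 0" and s: "of_int k * \<omega> + of_int l > 0"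
    and small: "real r * (of_int k * \<omega> + of_int l) < \<eta>" and "\<eta> > 0"
  obtains j j' where "j \<le> 0" "0 < j'"
    "\<And>i. j \<le> i \<and> i < j + int r \<or> j' \<le> i \<and> i < j' + int r \<Longrightarrow> translate k l a i - a i < \<eta>"
proof -
  define f where "f i = translate k l a i - a i" for i
  define s where "s = of_int k * \<omega> + of_int l"
  have f: "f i \<ge> 0" for i
    using birkhoff_le[OF a s] by (simp add: f_def translate_def)
  have total: "sum f {b..<b + L} \<le> of_int L * s + 2 * of_int (- k)" if "L \<ge> 0" for b L
  proof -
    have "sum f {b..<b + L} = (\<Sum>i\<in>{b..<b + L}. a (i - (- k)) - a i) + of_int L * of_int l"
      using that by (simp add: f_def translate_def sum.distrib sum_subtractf)
    also have "\<dots> \<le> of_int (- k) * (2 - of_int L * \<omega>) + of_int L * of_int l"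
      using birkhoff_telescope[OF a _ that, of "- k" b] k by simp
    finally show ?thesis by (simp add: s_def algebra_simps)
  qed
  have pos: "\<eta> - real r * s > 0" using small by (simp add: s_def)
  \<comment> \<open>With \<open>N\<close> blocks, the surplus \<open>\<eta> - real r * s\<close> per
    block outweighs the boundary term of the telescoped sum.\<close>
  obtain N where N: "2 * of_int (- k) / (\<eta> - real r * s) < real N" using reals_Archimedean2 by blast
  then have N': "real (r * N) * s + 2 * of_int (- k) < real N * \<eta>"
    using pos by (simp add: field_simps)
  have ex: "\<exists>j. b \<le> j \<and> j + int r \<le> b + int (r * N) \<and> (\<forall>i. j \<le> i \<and> i < j + int r \<longrightarrow> f i < \<eta>)" for b
  proof (rule ccontr)
    assume "\<not> ?thesis"
    then have "sum f {b..<b + int (r * N)} \<ge> real N * \<eta>"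
      by (intro sum_blocks f) force
    then show False using total[of "int (r * N)" b] N' by simp
  qed
  obtain j where j: "- int (r * N) \<le> j" "j + int r \<le> - int (r * N) + int (r * N)"
    "\<And>i. j \<le> i \<and> i < j + int r \<Longrightarrow> f i < \<eta>" using ex[of "- int (r * N)"] by blast
  obtain j' where j': "1 \<le> j'" "\<And>i. j' \<le> i \<and> i < j' + int r \<Longrightarrow> f i < \<eta>" using ex[of 1] by blast
  show thesis
    by (rule that[of j j']) (use j j' in \<open>auto simp: f_def\<close>)
qed

text \<open>In the factor 3, one translate comes from the bracketing of \<open>\<xi>\<close> and two
  from the almost-ordering, once in each direction.\<close>

lemma ground_states_close:
  assumes \<omega>: "\<omega> \<notin> \<rat>" and a: "ground_state \<omega> a" and c: "ground_state \<omega> c"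
    and s: "of_int k * \<omega> + of_int l > 0"
    and "a 0 \<le> \<xi>" "\<xi> \<le> translate k l a 0" "c 0 \<le> \<xi>" "\<xi> \<le> translate k l c 0"
  shows "translate (- 3 * k) (- 3 * l) a i \<le> c i" "c i \<le> translate (3 * k) (3 * l) a i"
proof -
  have "translate (- k) (- l) a (i - 2 * k) \<le> translate k l (translate k l c) (i - 2 * k)"
    by (rule ground_states_almost_ordered[OF \<omega> a ground_state_translate[OF c] _ s]) (use assms in simp)
  then show "translate (- 3 * k) (- 3 * l) a i \<le> c i" by (simp add: translate_def algebra_simps)
  have "translate (- k) (- l) c (i + k) \<le> translate k l (translate k l a) (i + k)"
    by (rule ground_states_almost_ordered[OF \<omega> c ground_state_translate[OF a] _ s]) (use assms in simp)
  then show "c i \<le> translate (3 * k) (3 * l) a i" by (simp add: translate_def algebra_simps)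
qed

definition modulus :: "real \<Rightarrow> real \<Rightarrow> real \<Rightarrow> bool" where
  "modulus K \<eta> \<epsilon> \<longleftrightarrow> (\<forall>x z j. tame K x \<longrightarrow> (\<forall>i. j \<le> i \<and> i \<le> j + int r \<longrightarrow> \<bar>z i - x i\<bar> \<le> \<eta>) \<longrightarrow>
     \<bar>loc z j - loc x j\<bar> \<le> \<epsilon>)"

text \<open>The sequence follows \<open>v\<close> up to \<open>j'\<close> and \<open>u\<close> on
  the rest of the period. Only windows across the two seams \<open>j'\<close> and
  \<open>j + p\<close> are affected, \<open>r\<close> at each, and the two sequences are close on
  the sites they read past the seam.\<close>

lemma glue:
  assumes u: "u \<in> periodic_seqs p q" and p: "p \<ge> 1" and j: "j \<le> j'" "j' - j + int r \<le> p"
    and tame: "tame K u" "tame K v" and mod: "modulus K \<eta> \<epsilon>" "\<eta> \<ge> 0" "\<epsilon> \<ge> 0"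
    and close: "\<And>i. j \<le> i \<and> i < j + int r \<or> j' \<le> i \<and> i < j' + int r \<Longrightarrow> \<bar>u i - v i\<bar> \<le> \<eta>"
  obtains z where "z \<in> periodic_seqs p q" "\<And>i. j \<le> i \<Longrightarrow> i < j' \<Longrightarrow> z i = v i"
    "action S p z \<le> action S p u + (\<Sum>i\<in>{j..<j'}. loc v i - loc u i) + 2 * real r * \<epsilon>"
proof -
  obtain z where z: "z \<in> periodic_seqs p q"
    "\<And>i. j \<le> i \<Longrightarrow> i < j + p \<Longrightarrow> z i = (if i < j' then v i else u i)"
    using periodic_extension[OF p, of q j "\<lambda>i. if i < j' then v i else u i"] by metis
  \<comment> \<open>Past the second seam the sequence has returned, one period later, to values of
    \<open>v\<close> near \<open>j\<close>.\<close>
  have zu: "\<bar>z i - u i\<bar> \<le> \<eta>" if "j + p \<le> i" "i < j + p + int r" for i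
  proof -
    have "z i = z (i - p) + of_int q" "u i = u (i - p) + of_int q"
      using z(1) u unfolding periodic_seqs_def by auto
    moreover have "\<bar>z (i - p) - u (i - p)\<bar> \<le> \<eta>"
      using z(2)[of "i - p"] that j close[of "i - p"] mod(2) by (auto simp: abs_minus_commute)
    ultimately show ?thesis by simp
  qed
  have le: "loc z i \<le> loc x i + \<epsilon>" if "tame K x" "\<And>b. i \<le> b \<Longrightarrow> b \<le> i + int r \<Longrightarrow> \<bar>z b - x b\<bar> \<le> \<eta>" for x i
  proof -
    have "\<bar>loc z i - loc x i\<bar> \<le> \<epsilon>" using mod(1) that unfolding modulus_def by blast
    then show ?thesis by linarith
  qed
  have 1: "(\<Sum>i\<in>{j..<j'}. loc z i) \<le> (\<Sum>i\<in>{j..<j'}. loc v i) + real (card {j' - int r..<j'}) * \<epsilon>"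
  proof (rule sum_le_boundary)
    show "loc z i = loc v i" if "i \<in> {j..<j'} - {j' - int r..<j'}" for i
      using that j by (intro loc_cong) (auto simp: z(2))
    show "loc z i \<le> loc v i + \<epsilon>" if "i \<in> {j..<j'}" for i
    proof (rule le[OF tame(2)])
      fix b assume "i \<le> b" "b \<le> i + int r"
      then show "\<bar>z b - v b\<bar> \<le> \<eta>" using that j close[of b] mod(2) by (auto simp: z(2))
    qed
  qed (use mod in auto)
  have 2: "(\<Sum>i\<in>{j'..<j + p}. loc z i) \<le> (\<Sum>i\<in>{j'..<j + p}. loc u i) + real (card {j + p - int r..<j + p}) * \<epsilon>"
  proof (rule sum_le_boundary)
    show "loc z i = loc u i" if "i \<in> {j'..<j + p} - {j + p - int r..<j + p}" for i
      using that j by (intro loc_cong) (auto simp: z(2))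
    show "loc z i \<le> loc u i + \<epsilon>" if "i \<in> {j'..<j + p}" for i
    proof (rule le[OF tame(1)])
      fix b assume "i \<le> b" "b \<le> i + int r"
      then show "\<bar>z b - u b\<bar> \<le> \<eta>" using that j zu[of b] mod(2) z(2)[of b] by (cases "b < j + p") auto
    qed
  qed (use mod in auto)
  have split: "action S p x = (\<Sum>i\<in>{j..<j'}. loc x i) + (\<Sum>i\<in>{j'..<j + p}. loc x i)"
    if "x \<in> periodic_seqs p q" for x
    using action_shift[OF that, of j] sum_int_split[of j j' "j + p" "loc x"] p j by simp
  have "action S p z \<le> action S p u + (\<Sum>i\<in>{j..<j'}. loc v i - loc u i) + 2 * real r * \<epsilon>"
    using 1 2 split[OF z(1)] split[OF u] by (simp add: sum_subtractf algebra_simps)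
  moreover have "z i = v i" if "j \<le> i" "i < j'" for i
    using z(2)[of i] that j by simp
  ultimately show thesis using that z(1) by blast
qed

text \<open>The piece of the constrained minimiser \<open>x\<close> over \<open>{j..<j'}\<close> is transplanted into \<open>c\<close>. Minimality
  of \<open>a\<close> bounds below both the action of \<open>c\<close> on that piece and the action of \<open>x\<close> off that piece.\<close>

lemma surgery:
  assumes a: "minimiser p q a" and x: "x \<in> periodic_seqs p q" and c: "minimiser p' q' c"
    and p: "p \<ge> 1" "p' \<ge> 1" and j: "j \<le> 0" "0 < j'" "j' - j + int r \<le> p" "j' - j + int r \<le> p'"
    and tame: "tame K a" "tame K x" "tame K c" and mod: "modulus K \<eta> \<epsilon>" "\<eta> \<ge> 0" "\<epsilon> \<ge> 0"
    and close: "\<And>i. j \<le> i \<and> i < j + int r \<or> j' \<le> i \<and> i < j' + int r \<Longrightarrow>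
      \<bar>a i - c i\<bar> \<le> \<eta> \<and> \<bar>x i - a i\<bar> \<le> \<eta> \<and> \<bar>c i - x i\<bar> \<le> \<eta>"
  obtains z where "z \<in> periodic_seqs p' q'" "z 0 = x 0"
    "action S p' z - action S p' c \<le> action S p x - action S p a + 6 * real r * \<epsilon>"
proof -
  have jj: "j \<le> j'" using j by simp
  obtain z where z: "z \<in> periodic_seqs p' q'" "\<And>i. j \<le> i \<Longrightarrow> i < j' \<Longrightarrow> z i = x i"
    "action S p' z \<le> action S p' c + (\<Sum>i\<in>{j..<j'}. loc x i - loc c i) + 2 * real r * \<epsilon>"
    using glue[OF minimiser_periodic[OF c] p(2) jj j(4) tame(3) tame(2) mod] close by metis
  obtain z1 where z1: "z1 \<in> periodic_seqs p q"
    "action S p z1 \<le> action S p a + (\<Sum>i\<in>{j..<j'}. loc c i - loc a i) + 2 * real r * \<epsilon>"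
    using glue[OF minimiser_periodic[OF a] p(1) jj j(3) tame(1) tame(3) mod] close by metis
  obtain z2 where z2: "z2 \<in> periodic_seqs p q"
    "action S p z2 \<le> action S p x + (\<Sum>i\<in>{j..<j'}. loc a i - loc x i) + 2 * real r * \<epsilon>"
    using glue[OF x p(1) jj j(3) tame(2) tame(1) mod] close by metis
  \<comment> \<open>Adding the three gluing estimates cancels the sums of \<open>a\<close>,
    \<open>c\<close> and \<open>x\<close> over the piece; each contributes an error of
    \<open>2 * r * \<epsilon>\<close>.\<close>
  have "action S p a \<le> action S p z1" "action S p a \<le> action S p z2"
    using a z1(1) z2(1) unfolding minimiser_def by auto
  then have "action S p' z - action S p' c \<le> action S p x - action S p a + 6 * real r * \<epsilon>"
    using z(3) z1(2) z2(2) by (simp add: sum_subtractf)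
  moreover have "z 0 = x 0" using z(2) j by simp
  ultimately show thesis using that z(1) by blast
qed

lemma peierls_rat_eq:
  assumes "quotient_of \<rho> = (q, p)" "minimiser p q a" "y \<in> {x \<in> periodic_seqs p q. x 0 = \<xi>}"
    "\<And>x. x \<in> {x \<in> periodic_seqs p q. x 0 = \<xi>} \<Longrightarrow> action S p y \<le> action S p x"
  shows "peierls_rat S \<rho> \<xi> = action S p y - action S p a"
proof -
  have "(LEAST w. w \<in> action S p ` {x \<in> periodic_seqs p q. x 0 = \<xi>}) = action S p y"
    by (rule Least_image_minimiser) (fact assms(3), fact assms(4))
  moreover have "(LEAST w. w \<in> action S p ` periodic_seqs p q) = action S p a"
    by (rule Least_image_minimiser) (use assms(2) in \<open>auto simp: minimiser_def\<close>)
  ultimately show ?thesis by (simp add: peierls_rat_def assms(1))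
qed

lemma peierls_rat_le:
  assumes "quotient_of \<rho> = (q, p)" "minimiser p q a" "x \<in> periodic_seqs p q" "x 0 = \<xi>"
  shows "peierls_rat S \<rho> \<xi> \<le> action S p x - action S p a"
proof -
  have p: "p \<ge> 1" using quotient_of_denom_pos[OF assms(1)] by simp
  obtain y where y: "y \<in> {x \<in> periodic_seqs p q. x 0 = \<xi>}"
    "\<And>x. x \<in> {x \<in> periodic_seqs p q. x 0 = \<xi>} \<Longrightarrow> action S p y \<le> action S p x"
    using ex_constrained_minimiser[OF p] by blast
  have "peierls_rat S \<rho> \<xi> = action S p y - action S p a"
    by (rule peierls_rat_eq[OF assms(1,2) y])
  then show ?thesis using y(2)[of x] assms by simp
qed

text \<open>A constrained minimiser may be truncated to lie between \<open>a\<close> and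
  \<open>b\<close>: by submodularity, and since \<open>a\<close> and \<open>b\<close> are
  minimisers, neither truncation raises the action, and the value at site 0 is kept.\<close>

lemma peierls_rat_attained:
  assumes "quotient_of \<rho> = (q, p)" "minimiser p q a" "minimiser p q b" "a 0 \<le> \<xi>" "\<xi> \<le> b 0" "\<And>i. a i \<le> b i"
  obtains x where "x \<in> periodic_seqs p q" "x 0 = \<xi>" "\<And>i. a i \<le> x i" "\<And>i. x i \<le> b i"
    "peierls_rat S \<rho> \<xi> = action S p x - action S p a"
proof -
  have p: "p \<ge> 1" using quotient_of_denom_pos[OF assms(1)] by simp
  obtain y where y: "y \<in> {x \<in> periodic_seqs p q. x 0 = \<xi>}"
    "\<And>x. x \<in> {x \<in> periodic_seqs p q. x 0 = \<xi>} \<Longrightarrow> action S p y \<le> action S p x"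
    using ex_constrained_minimiser[OF p] by blast
  have eq: "peierls_rat S \<rho> \<xi> = action S p y - action S p a"
    by (rule peierls_rat_eq[OF assms(1,2) y])
  note per = minimiser_periodic[OF assms(2)] minimiser_periodic[OF assms(3)]
  define y1 where "y1 i = min (y i) (b i)" for i
  have y1: "y1 \<in> periodic_seqs p q" using min_max_periodic y per unfolding y1_def by blast
  define x where "x i = max (y1 i) (a i)" for i
  have x: "x \<in> periodic_seqs p q" using min_max_periodic y1 per unfolding x_def by blast
  have "action S p b \<le> action S p (\<lambda>i. max (y i) (b i))"
    using assms(3) min_max_periodic(2)[of y p q b] y per unfolding minimiser_def by blast
  then have "action S p y1 \<le> action S p y"
    using action_min_max[of p y b] unfolding y1_def by linarith
  moreover have "action S p a \<le> action S p (\<lambda>i. min (y1 i) (a i))"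
    using assms(2) min_max_periodic(1)[of y1 p q a] y1 per unfolding minimiser_def by blast
  then have "action S p x \<le> action S p y1"
    using action_min_max[of p y1 a] unfolding x_def by linarith
  moreover have x0: "x 0 = \<xi>" using y(1) assms(4,5) by (simp add: x_def y1_def)
  then have "action S p y \<le> action S p x" using y(2) x by simp
  ultimately have "action S p x = action S p y" by simp
  moreover have "a i \<le> x i" "x i \<le> b i" for i
    using assms(6)[of i] by (auto simp: x_def y1_def)
  ultimately show thesis using that[OF x x0] eq by simp
qed

lemma peierls_rat_add_int: "peierls_rat S \<rho> (\<xi> + of_int l) = peierls_rat S \<rho> \<xi>"
proof -
  obtain q p where qp: "quotient_of \<rho> = (q, p)" by fastforce
  have p: "p \<ge> 0" using quotient_of_denom_pos[OF qp] by simp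
  have sub: "action S p ` {x \<in> periodic_seqs p q. x 0 = \<xi>} \<subseteq> action S p ` {x \<in> periodic_seqs p q. x 0 = \<xi> + of_int l}"
    for \<xi> l
  proof
    fix w assume "w \<in> action S p ` {x \<in> periodic_seqs p q. x 0 = \<xi>}"
    then obtain x where x: "x \<in> periodic_seqs p q" "x 0 = \<xi>" "w = action S p x" by auto
    have "w = action S p (translate 0 l x)" using action_translate[OF x(1) p] x(3) by simp
    moreover have "translate 0 l x \<in> {x \<in> periodic_seqs p q. x 0 = \<xi> + of_int l}"
      using translate_periodic[OF x(1)] x(2) by (simp add: translate_def)
    ultimately show "w \<in> action S p ` {x \<in> periodic_seqs p q. x 0 = \<xi> + of_int l}" by blast
  qed
  have "action S p ` {x \<in> periodic_seqs p q. x 0 = \<xi> + of_int l} = action S p ` {x \<in> periodic_seqs p q. x 0 = \<xi>}"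
    using sub[of "\<xi> + of_int l" "- l"] sub[of \<xi> l] by (intro equalityI) simp_all
  then show ?thesis by (simp add: peierls_rat_def qp)
qed

text \<open>The iterated translates of one minimiser take values at site 0 that run from minus to
  plus infinity, so \<open>\<xi>\<close> falls between two consecutive ones.\<close>

lemma ex_bracketing_minimiser:
  assumes p: "p \<ge> int r + 1" and s: "of_int k * (of_int q / of_int p) + of_int l > (0 :: real)"
  shows "\<exists>a. minimiser p q a \<and> a 0 \<le> \<xi> \<and> \<xi> \<le> translate k l a 0"
proof -
  have p1: "p \<ge> 1" using p by simp
  obtain y where y: "minimiser p q y" using ex_minimiser[OF p1] by blast
  define s where "s = of_int k * (of_int q / of_int p) + (of_int l :: real)"
  have s0: "s > 0" using assms(2) by (simp add: s_def)
  define h where "h N = y (N * k) + of_int (N * l)" for N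
  have dev: "\<bar>h N - y 0 - of_int N * s\<bar> \<le> 2" for N
    using birkhoff_deviation[OF minimiser_birkhoff[OF y p], of 0 "N * k"]
    by (simp add: h_def s_def algebra_simps)
  define B where "B = \<bar>\<xi>\<bar> + \<bar>y 0\<bar> + 3"
  obtain n where n: "B / s < real n" using reals_Archimedean2 by blast
  then have n': "B < real n * s" using s0 by (simp add: field_simps)
  have "h (- int n) \<le> \<xi>" using dev[of "- int n"] n' by (simp add: B_def)
  moreover have "\<not> h (int n) \<le> \<xi>" using dev[of "int n"] n' by (simp add: B_def)
  ultimately obtain N where N: "h N \<le> \<xi>" "\<not> h (N + 1) \<le> \<xi>"
    using int_crossing[of "\<lambda>N. h N \<le> \<xi>" "- int n" "int n"] by auto
  let ?a = "translate (N * k) (N * l) y"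
  have "?a 0 = h N" "translate k l ?a 0 = h (N + 1)"
    by (simp_all add: h_def translate_def algebra_simps)
  then show ?thesis using N minimiser_translate[OF y, of "N * k" "N * l"] p1 by (intro exI[of _ ?a]) simp
qed


lemma ex_bracketed_constrained_minimiser:
  assumes \<rho>: "quotient_of \<rho> = (q, p)" and p: "p \<ge> int r + 1" and s: "of_int k * real_of_rat \<rho> + of_int l > 0"
  shows "\<exists>a x. minimiser p q a \<and> a 0 \<le> \<xi> \<and> \<xi> \<le> translate k l a 0 \<and> x \<in> periodic_seqs p q \<and> x 0 = \<xi> \<and>
    (\<forall>i. a i \<le> x i \<and> x i \<le> translate k l a i) \<and> peierls_rat S \<rho> \<xi> = action S p x - action S p a"
proof -
  have \<rho>': "real_of_rat \<rho> = of_int q / of_int p"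
    using quotient_of_div[OF \<rho>] by (simp add: of_rat_divide)
  note s' = s[unfolded \<rho>']
  obtain a where a: "minimiser p q a" "a 0 \<le> \<xi>" "\<xi> \<le> translate k l a 0"
    using ex_bracketing_minimiser[OF p s'] by blast
  have b: "minimiser p q (translate k l a)" using minimiser_translate[OF a(1)] p by simp
  have "a i \<le> translate k l a i" for i
    using birkhoff_le[OF minimiser_birkhoff[OF a(1) p] s'] by (simp add: translate_def)
  then obtain x where "x \<in> periodic_seqs p q" "x 0 = \<xi>" "\<And>i. a i \<le> x i" "\<And>i. x i \<le> translate k l a i"
    "peierls_rat S \<rho> \<xi> = action S p x - action S p a"
    using peierls_rat_attained[OF \<rho> a(1) b a(2,3)] by metis
  then show ?thesis using a by blast
qed

end

section \<open>The uniform estimate for rational barriers by compactness\<close>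

context local_potential
begin

text \<open>A counterexample for every \<open>\<delta>\<close> gives sequences of bracketing
  minimisers for two rotation numbers tending to \<open>\<omega>\<close>. Limits of these are ground
  states of the same irrational rotation number, hence close on suitable windows, and surgery at a
  late index contradicts the choice.\<close>

lemma peierls_rat_upper:
  assumes \<omega>: "\<omega> \<notin> \<rat>" and \<epsilon>: "\<epsilon> > 0"
  shows "\<exists>\<delta>>0. \<forall>\<rho> \<rho>' \<xi>. \<bar>real_of_rat \<rho> - \<omega>\<bar> < \<delta> \<longrightarrow> \<bar>real_of_rat \<rho>' - \<omega>\<bar> < \<delta> \<longrightarrow>
     peierls_rat S \<rho>' \<xi> \<le> peierls_rat S \<rho> \<xi> + \<epsilon>"
proof (rule ccontr)
  assume contr: "\<not> ?thesis"
  define \<epsilon>' where "\<epsilon>' = \<epsilon> / (6 * real r)"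
  have \<epsilon>': "\<epsilon>' > 0" "6 * real r * \<epsilon>' = \<epsilon>" using \<epsilon> r_pos by (auto simp: \<epsilon>'_def)
  \<comment> \<open>Nearby rotation numbers are below \<open>\<bar>\<omega>\<bar> + 1\<close> in
    modulus, which gives oscillation at most \<open>K - 1\<close> for the minimisers; the
    constrained ones lie less than or equal to 1 above them.\<close>
  define K where "K = real r * (\<bar>\<omega>\<bar> + 1) + 3"
  obtain \<eta> where \<eta>: "\<eta> > 0" "modulus K \<eta> \<epsilon>'"
    using loc_uniformly_continuous[OF \<epsilon>'(1), of K] unfolding modulus_def by blast
  \<comment> \<open>The limits will lie in a band six translates wide, whose height times
    \<open>r\<close> must be below \<open>\<eta> / 2\<close>; hence the 12. The bound 1 limits the
    band containing the constrained minimiser.\<close>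
  have "min 1 (\<eta> / (12 * real r)) > 0" using \<eta>(1) r_pos by simp
  then obtain k l :: int where kl: "k < 0" "0 < of_int k * \<omega> + of_int l"
      "of_int k * \<omega> + of_int l < min 1 (\<eta> / (12 * real r))"
    using irrational_small_combination[OF \<omega>, of _ 0] by blast
  have "((\<lambda>t. of_int k * t + of_int l) \<longlongrightarrow> of_int k * \<omega> + of_int l) (nhds \<omega>)"
    by (intro tendsto_intros filterlim_ident)
  moreover have "((\<lambda>t. \<bar>t\<bar>) \<longlongrightarrow> \<bar>\<omega>\<bar>) (nhds \<omega>)" by (intro tendsto_intros filterlim_ident)
  ultimately have "\<forall>\<^sub>F t in nhds \<omega>. (0 < of_int k * t + of_int l \<and> of_int k * t + of_int l < 1) \<and> \<bar>t\<bar> < \<bar>\<omega>\<bar> + 1"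
    using kl by (intro eventually_conj; elim order_tendstoD) auto
  then obtain \<delta>1 where \<delta>1: "\<delta>1 > 0" "\<And>t. \<bar>t - \<omega>\<bar> < \<delta>1 \<Longrightarrow>
      0 < of_int k * t + of_int l \<and> of_int k * t + of_int l < 1 \<and> \<bar>t\<bar> < \<bar>\<omega>\<bar> + 1"
    unfolding eventually_nhds_metric dist_real_def by blast
  have denom: "\<exists>\<delta>>0. \<forall>\<rho> q p. \<bar>real_of_rat \<rho> - \<omega>\<bar> < \<delta> \<longrightarrow> quotient_of \<rho> = (q, p) \<longrightarrow> p > int N" for N
  proof -
    obtain \<delta> where \<delta>: "\<delta> > 0"
      "\<And>(q::int) (p::int). 1 \<le> p \<Longrightarrow> \<bar>of_int q / of_int p - \<omega>\<bar> < \<delta> \<Longrightarrow> p > int N"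
      using irrational_denominator_large[OF \<omega>, of N] by blast
    have "p > int N" if "\<bar>real_of_rat \<rho> - \<omega>\<bar> < \<delta>" "quotient_of \<rho> = (q, p)" for \<rho> q p
      using \<delta>(2)[of p q] that quotient_of_div[OF that(2)] quotient_of_denom_pos[OF that(2)]
      by (simp add: of_rat_divide)
    then show ?thesis using \<delta>(1) by blast
  qed
  obtain \<delta>2 where \<delta>2: "\<delta>2 > 0" "\<And>\<rho> q p. \<bar>real_of_rat \<rho> - \<omega>\<bar> < \<delta>2 \<Longrightarrow> quotient_of \<rho> = (q, p) \<Longrightarrow> p > int r"
    using denom[of r] by blast
  define D where "D n = min (min \<delta>1 \<delta>2) (inverse (real (Suc n)))" for n
  have D: "D n > 0" "D n \<le> \<delta>1" "D n \<le> \<delta>2" "D n \<le> inverse (real (Suc n))" for n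
    using \<delta>1(1) \<delta>2(1) by (auto simp: D_def)
  have "\<exists>\<rho> \<rho>' \<xi>. \<bar>real_of_rat \<rho> - \<omega>\<bar> < D n \<and> \<bar>real_of_rat \<rho>' - \<omega>\<bar> < D n \<and> 0 \<le> \<xi> \<and> \<xi> \<le> 1 \<and>
      peierls_rat S \<rho>' \<xi> > peierls_rat S \<rho> \<xi> + \<epsilon>" for n
  proof -
    obtain \<rho> \<rho>' \<xi> where *: "\<bar>real_of_rat \<rho> - \<omega>\<bar> < D n" "\<bar>real_of_rat \<rho>' - \<omega>\<bar> < D n"
      "peierls_rat S \<rho>' \<xi> > peierls_rat S \<rho> \<xi> + \<epsilon>"
      using contr D(1)[of n] by (meson not_le)
    have "\<xi> = frac \<xi> + of_int \<lfloor>\<xi>\<rfloor>" by (simp add: frac_def)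
    then have "peierls_rat S \<sigma> \<xi> = peierls_rat S \<sigma> (frac \<xi>)" for \<sigma>
      using peierls_rat_add_int by metis
    then show ?thesis using * frac_ge_0[of \<xi>] frac_lt_1[of \<xi>] by (metis less_imp_le)
  qed
  then obtain \<rho> \<rho>' \<xi> where seq: "\<And>n. \<bar>real_of_rat (\<rho> n) - \<omega>\<bar> < D n" "\<And>n. \<bar>real_of_rat (\<rho>' n) - \<omega>\<bar> < D n"
    "\<And>n. 0 \<le> \<xi> n" "\<And>n. \<xi> n \<le> 1" "\<And>n. peierls_rat S (\<rho>' n) (\<xi> n) > peierls_rat S (\<rho> n) (\<xi> n) + \<epsilon>"
    by metis
  have data: "\<exists>q p a x. \<forall>n::nat. quotient_of (\<sigma> n) = (q n, p n) \<and> p n > int r \<and> minimiser (p n) (q n) (a n) \<and>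
      a n 0 \<le> \<xi> n \<and> \<xi> n \<le> translate k l (a n) 0 \<and> x n \<in> periodic_seqs (p n) (q n) \<and> x n 0 = \<xi> n \<and>
      (\<forall>i. a n i \<le> x n i \<and> x n i \<le> translate k l (a n) i) \<and>
      peierls_rat S (\<sigma> n) (\<xi> n) = action S (p n) (x n) - action S (p n) (a n) \<and>
      tame K (a n) \<and> tame K (x n) \<and> (\<forall>i. \<bar>a n i\<bar> \<le> 3 + of_int \<bar>i\<bar> * (\<bar>\<omega>\<bar> + 1))"
    if \<sigma>: "\<And>n. \<bar>real_of_rat (\<sigma> n) - \<omega>\<bar> < D n" for \<sigma>
  proof -
    have "\<exists>q p a x. quotient_of (\<sigma> n) = (q, p) \<and> p > int r \<and> minimiser p q a \<and>
      a 0 \<le> \<xi> n \<and> \<xi> n \<le> translate k l a 0 \<and> x \<in> periodic_seqs p q \<and> x 0 = \<xi> n \<and>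
      (\<forall>i. a i \<le> x i \<and> x i \<le> translate k l a i) \<and>
      peierls_rat S (\<sigma> n) (\<xi> n) = action S p x - action S p a \<and>
      tame K a \<and> tame K x \<and> (\<forall>i. \<bar>a i\<bar> \<le> 3 + of_int \<bar>i\<bar> * (\<bar>\<omega>\<bar> + 1))" for n
    proof -
      obtain q p where qp: "quotient_of (\<sigma> n) = (q, p)" by fastforce
      have p: "p \<ge> int r + 1" using \<delta>2(2)[OF _ qp] \<sigma>[of n] D(3)[of n] by simp
      define t where "t = real_of_rat (\<sigma> n)"
      have t: "0 < of_int k * t + of_int l" "of_int k * t + of_int l < 1" "\<bar>t\<bar> < \<bar>\<omega>\<bar> + 1"
        using \<delta>1(2)[of t] \<sigma>[of n] D(2)[of n] by (auto simp: t_def)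
      obtain a x where ax: "minimiser p q a" "a 0 \<le> \<xi> n" "\<xi> n \<le> translate k l a 0" "x \<in> periodic_seqs p q"
          "x 0 = \<xi> n" "\<And>i. a i \<le> x i \<and> x i \<le> translate k l a i"
          "peierls_rat S (\<sigma> n) (\<xi> n) = action S p x - action S p a"
        using ex_bracketed_constrained_minimiser[OF qp p t(1)[unfolded t_def]] by metis
      have tq: "t = of_int q / of_int p"
        using quotient_of_div[OF qp] by (simp add: of_rat_divide t_def)
      have ba: "birkhoff t a" unfolding tq by (rule minimiser_birkhoff[OF ax(1) p])
      have up: "translate k l a i \<le> a i + 1" for i
        using birkhoff_le[OF ba, of "- k" "1 - l" "i + k"] t(2) by (simp add: translate_def)
      have rt: "real r * \<bar>t\<bar> \<le> real r * (\<bar>\<omega>\<bar> + 1)" using t(3) by (intro mult_left_mono) auto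
      have ta: "\<bar>a i - a j\<bar> \<le> K - 1" if "\<bar>i - j\<bar> \<le> int r" for i j
        using birkhoff_tame[OF ba] that rt unfolding tame_def K_def by fastforce
      then have "tame K a" unfolding tame_def by fastforce
      moreover have "tame K x" unfolding tame_def
      proof (intro allI impI)
        fix i j :: int assume "\<bar>i - j\<bar> \<le> int r"
        from ta[OF this] show "\<bar>x i - x j\<bar> \<le> K"
          using ax(6)[of i] ax(6)[of j] up[of i] up[of j] by linarith
      qed
      moreover have "\<bar>a i\<bar> \<le> 3 + of_int \<bar>i\<bar> * (\<bar>\<omega>\<bar> + 1)" for i
      proof -
        have "\<bar>of_int i * t\<bar> \<le> of_int \<bar>i\<bar> * (\<bar>\<omega>\<bar> + 1)"
          unfolding abs_mult of_int_abs using t(3) by (intro mult_left_mono) auto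
        then show ?thesis
          using birkhoff_deviation[OF ba, of 0 i] up[of 0] ax(2,3) seq(3,4)[of n] by simp
      qed
      ultimately show ?thesis using qp p ax by (intro exI[of _ q] exI[of _ p] exI[of _ a] exI[of _ x]) simp
    qed
    then show ?thesis by metis
  qed
  obtain q p a x where A: "\<And>n. quotient_of (\<rho> n) = (q n, p n)" "\<And>n. p n > int r"
      "\<And>n. minimiser (p n) (q n) (a n)" "\<And>n. a n 0 \<le> \<xi> n" "\<And>n. \<xi> n \<le> translate k l (a n) 0"
      "\<And>n. x n \<in> periodic_seqs (p n) (q n)" "\<And>n. x n 0 = \<xi> n"
      "\<And>n i. a n i \<le> x n i" "\<And>n i. x n i \<le> translate k l (a n) i"
      "\<And>n. peierls_rat S (\<rho> n) (\<xi> n) = action S (p n) (x n) - action S (p n) (a n)"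
      "\<And>n. tame K (a n)" "\<And>n. tame K (x n)" "\<And>n i. \<bar>a n i\<bar> \<le> 3 + of_int \<bar>i\<bar> * (\<bar>\<omega>\<bar> + 1)"
    using data[of \<rho>, OF seq(1)] by blast
  obtain q' p' c where C: "\<And>n. quotient_of (\<rho>' n) = (q' n, p' n)" "\<And>n. p' n > int r"
      "\<And>n. minimiser (p' n) (q' n) (c n)" "\<And>n. c n 0 \<le> \<xi> n" "\<And>n. \<xi> n \<le> translate k l (c n) 0"
      "\<And>n. tame K (c n)" "\<And>n i. \<bar>c n i\<bar> \<le> 3 + of_int \<bar>i\<bar> * (\<bar>\<omega>\<bar> + 1)"
    using data[of \<rho>', OF seq(2)] by blast
  have D0: "D \<longlonglongrightarrow> 0"
    by (rule tendsto_sandwich[OF _ _ tendsto_const LIMSEQ_inverse_real_of_nat])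
       (use D in \<open>auto intro!: always_eventually less_imp_le\<close>)
  have conv: "(\<lambda>n. of_int (q n) / of_int (p n)) \<longlonglongrightarrow> \<omega>" "filterlim p at_top sequentially"
    if \<sigma>: "\<And>n. \<bar>real_of_rat (\<sigma> n) - \<omega>\<bar> < D n" and qp: "\<And>n. quotient_of (\<sigma> n) = (q n, p n)" for \<sigma> q p
  proof -
    have "(\<lambda>n. real_of_rat (\<sigma> n) - \<omega>) \<longlonglongrightarrow> 0"
      by (rule Lim_null_comparison[OF _ D0]) (use \<sigma> in \<open>auto intro!: always_eventually less_imp_le\<close>)
    then have "(\<lambda>n. real_of_rat (\<sigma> n)) \<longlonglongrightarrow> \<omega>" by (simp add: LIM_zero_iff)
    moreover have "real_of_rat (\<sigma> n) = of_int (q n) / of_int (p n)" for n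
      using quotient_of_div[OF qp] by (simp add: of_rat_divide)
    ultimately show "(\<lambda>n. of_int (q n) / of_int (p n)) \<longlonglongrightarrow> \<omega>" by simp
    show "filterlim p at_top sequentially"
      unfolding filterlim_at_top
    proof
      fix Z
      obtain \<delta> where \<delta>: "\<delta> > 0" "\<And>\<rho> q p. \<bar>real_of_rat \<rho> - \<omega>\<bar> < \<delta> \<Longrightarrow> quotient_of \<rho> = (q, p) \<Longrightarrow> p > int (nat Z)"
        using denom[of "nat Z"] by blast
      have "\<forall>\<^sub>F n in sequentially. D n < \<delta>" using order_tendstoD(2)[OF D0 \<delta>(1)] .
      then show "\<forall>\<^sub>F n in sequentially. Z \<le> p n"
      proof eventually_elim
        case (elim n)
        then have "int (nat Z) < p n" using \<delta>(2)[OF _ qp[of n]] \<sigma>[of n] by simp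
        then show ?case by linarith
      qed
    qed
  qed
  \<comment> \<open>Both families and the values \<open>\<xi> n\<close> are packed into one
    countable family, so that a single subsequence serves all of them.\<close>
  define F where "F n = (\<lambda>(b :: nat, i :: int). if b = 0 then a n i else if b = 1 then c n i else \<xi> n)" for n
  have F_bound: "\<bar>F n b\<bar> \<le> 3 + of_int \<bar>snd b\<bar> * (\<bar>\<omega>\<bar> + 1)" for n b
  proof -
    have "0 \<le> of_int \<bar>snd b\<bar> * (\<bar>\<omega>\<bar> + 1)" by simp
    then have "\<bar>\<xi> n\<bar> \<le> 3 + of_int \<bar>snd b\<bar> * (\<bar>\<omega>\<bar> + 1)"
      using seq(3,4)[of n] by linarith
    then show ?thesis
      using A(13)[of n "snd b"] C(7)[of n "snd b"] by (simp add: F_def split_beta)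
  qed
  obtain \<phi> g where \<phi>: "strict_mono \<phi>" and g: "\<And>b. (\<lambda>n. F (\<phi> n) b) \<longlonglongrightarrow> g b"
    using pointwise_convergent_subsequence[of F, OF F_bound] by metis
  define a' where "a' i = g (0, i)" for i
  define c' where "c' i = g (1, i)" for i
  define \<xi>' where "\<xi>' = g (2, 0)"
  have lim: "(\<lambda>n. a (\<phi> n) i) \<longlonglongrightarrow> a' i" "(\<lambda>n. c (\<phi> n) i) \<longlonglongrightarrow> c' i" "(\<lambda>n. \<xi> (\<phi> n)) \<longlonglongrightarrow> \<xi>'" for i
    using g[of "(0, i)"] g[of "(1, i)"] g[of "(2, 0)"] by (auto simp: F_def a'_def c'_def \<xi>'_def)
  have limt: "(\<lambda>n. translate e f (a (\<phi> n)) i) \<longlonglongrightarrow> translate e f a' i"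
    "(\<lambda>n. translate e f (c (\<phi> n)) i) \<longlonglongrightarrow> translate e f c' i" for e f i
    unfolding translate_def by (intro tendsto_intros lim)+
  note conv\<rho> = conv[OF seq(1) A(1)] and conv\<rho>' = conv[OF seq(2) C(1)]
  have ground: "ground_state \<omega> a'" "ground_state \<omega> c'"
  proof -
    note sub = filterlim_subseq[OF \<phi>]
    show "ground_state \<omega> a'"
      by (rule minimisers_tendsto_ground_state[OF A(3) filterlim_compose[OF conv\<rho>(2) sub] filterlim_compose[OF conv\<rho>(1) sub] lim(1)])
    show "ground_state \<omega> c'"
      by (rule minimisers_tendsto_ground_state[OF C(3) filterlim_compose[OF conv\<rho>'(2) sub] filterlim_compose[OF conv\<rho>'(1) sub] lim(2)])
  qed
  have bracket: "a' 0 \<le> \<xi>'" "\<xi>' \<le> translate k l a' 0" "c' 0 \<le> \<xi>'" "\<xi>' \<le> translate k l c' 0"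
    using LIMSEQ_le[OF lim(1) lim(3)] LIMSEQ_le[OF lim(3) limt(1)] LIMSEQ_le[OF lim(2) lim(3)]
      LIMSEQ_le[OF lim(3) limt(2)] A(4,5) C(4,5) by blast+
  note close = ground_states_close[OF \<omega> ground kl(2) bracket]
  note ba = ground_state_birkhoff[OF ground(1)]
  \<comment> \<open>The band from \<open>b\<close> to its translate by \<open>(6 * k, 6 * l)\<close>
    contains \<open>c'\<close> as well as \<open>a'\<close> and the translate bounding the
    constrained minimiser. Thinness of this band on a window therefore gives all the closeness
    needed.\<close>
  define b where "b = translate (- 3 * k) (- 3 * l) a'"
  have six: "of_int (6 * k) * \<omega> + of_int (6 * l) = 6 * (of_int k * \<omega> + of_int l)" by (simp add: algebra_simps)
  have "of_int k * \<omega> + of_int l < \<eta> / (12 * real r)" using kl(3) by simp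
  then have "(of_int k * \<omega> + of_int l) * (12 * real r) < \<eta>" using r_pos by (simp add: pos_less_divide_eq)
  then have small: "real r * (of_int (6 * k) * \<omega> + of_int (6 * l)) < \<eta> / 2"
    unfolding six by (simp add: algebra_simps)
  have pos6: "of_int (6 * k) * \<omega> + of_int (6 * l) > 0" unfolding six using kl(2) by simp
  have bb: "birkhoff \<omega> b" unfolding b_def by (rule birkhoff_translate[OF ba])
  have k6: "6 * k \<le> 0" using kl(1) by simp
  obtain j j' where j: "j \<le> 0" "0 < j'"
    "\<And>i. j \<le> i \<and> i < j + int r \<or> j' \<le> i \<and> i < j' + int r \<Longrightarrow> translate (6 * k) (6 * l) b i - b i < \<eta> / 2"
    using close_windows[OF bb k6 pos6 small half_gt_zero[OF \<eta>(1)]] by metis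
  define W where "W = {j..<j + int r} \<union> {j'..<j' + int r}"
  have W: "\<bar>a' i - c' i\<bar> < \<eta> / 2" "translate k l a' i - a' i < \<eta> / 2" if "i \<in> W" for i
  proof -
    have "translate (6 * k) (6 * l) b i - b i < \<eta> / 2" using that j(3)[of i] by (auto simp: W_def)
    moreover have "translate (6 * k) (6 * l) b i = translate (3 * k) (3 * l) a' i"
      by (simp add: b_def translate_def algebra_simps)
    moreover have "b i \<le> translate 0 0 a' i" "translate k l a' i \<le> translate (3 * k) (3 * l) a' i"
       "translate 0 0 a' i \<le> translate k l a' i"
      unfolding b_def by (rule birkhoff_translate_mono[OF ba], use kl(2) in \<open>simp add: algebra_simps\<close>)+
    moreover have "translate 0 0 a' i = a' i" by (simp add: translate_def)
    ultimately show "\<bar>a' i - c' i\<bar> < \<eta> / 2" "translate k l a' i - a' i < \<eta> / 2"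
      using close[of i, folded b_def] by linarith+
  qed
  have "\<forall>\<^sub>F n in sequentially. \<bar>a (\<phi> n) i - c (\<phi> n) i\<bar> < \<eta> / 2 \<and> translate k l (a (\<phi> n)) i - a (\<phi> n) i < \<eta> / 2"
    if "i \<in> W" for i
  proof (rule eventually_conj)
    have "(\<lambda>n. \<bar>a (\<phi> n) i - c (\<phi> n) i\<bar>) \<longlonglongrightarrow> \<bar>a' i - c' i\<bar>" by (intro tendsto_intros lim)
    then show "\<forall>\<^sub>F n in sequentially. \<bar>a (\<phi> n) i - c (\<phi> n) i\<bar> < \<eta> / 2"
      using W(1)[OF that] by (rule order_tendstoD)
    have "(\<lambda>n. translate k l (a (\<phi> n)) i - a (\<phi> n) i) \<longlonglongrightarrow> translate k l a' i - a' i"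
      by (intro tendsto_diff limt lim)
    then show "\<forall>\<^sub>F n in sequentially. translate k l (a (\<phi> n)) i - a (\<phi> n) i < \<eta> / 2"
      using W(2)[OF that] by (rule order_tendstoD)
  qed
  \<comment> \<open>The set \<open>W\<close> is finite, so the strict inequalities of the limits
    hold on it simultaneously at late indices.\<close>
  then have evW: "\<forall>\<^sub>F n in sequentially. \<forall>i\<in>W. \<bar>a (\<phi> n) i - c (\<phi> n) i\<bar> < \<eta> / 2 \<and>
      translate k l (a (\<phi> n)) i - a (\<phi> n) i < \<eta> / 2"
    by (intro eventually_ball_finite) (auto simp: W_def)
  have "\<forall>\<^sub>F n in sequentially. p (\<phi> n) \<ge> j' - j + int r" "\<forall>\<^sub>F n in sequentially. p' (\<phi> n) \<ge> j' - j + int r"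
    using filterlim_compose[OF conv\<rho>(2) filterlim_subseq[OF \<phi>]] filterlim_compose[OF conv\<rho>'(2) filterlim_subseq[OF \<phi>]]
    unfolding filterlim_at_top by blast+
  with evW have ev: "\<forall>\<^sub>F n in sequentially. (\<forall>i\<in>W. \<bar>a (\<phi> n) i - c (\<phi> n) i\<bar> < \<eta> / 2 \<and>
      translate k l (a (\<phi> n)) i - a (\<phi> n) i < \<eta> / 2) \<and> p (\<phi> n) \<ge> j' - j + int r \<and> p' (\<phi> n) \<ge> j' - j + int r"
    by eventually_elim auto
  obtain n where n: "\<And>i. i \<in> W \<Longrightarrow> \<bar>a (\<phi> n) i - c (\<phi> n) i\<bar> < \<eta> / 2 \<and>
      translate k l (a (\<phi> n)) i - a (\<phi> n) i < \<eta> / 2" "p (\<phi> n) \<ge> j' - j + int r" "p' (\<phi> n) \<ge> j' - j + int r"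
    using eventually_happens'[OF sequentially_bot ev] by blast
  define N where "N = \<phi> n"
  note n = n[folded N_def]
  have close: "\<bar>a N i - c N i\<bar> \<le> \<eta> \<and> \<bar>x N i - a N i\<bar> \<le> \<eta> \<and> \<bar>c N i - x N i\<bar> \<le> \<eta>"
    if "j \<le> i \<and> i < j + int r \<or> j' \<le> i \<and> i < j' + int r" for i
  proof -
    have "i \<in> W" using that by (auto simp: W_def)
    from n(1)[OF this] show ?thesis using A(8)[of N i] A(9)[of N i] by linarith
  qed
  have p1: "p N \<ge> 1" "p' N \<ge> 1" using A(2)[of N] C(2)[of N] by simp_all
  obtain z where z: "z \<in> periodic_seqs (p' N) (q' N)" "z 0 = x N 0"
    "action S (p' N) z - action S (p' N) (c N) \<le> action S (p N) (x N) - action S (p N) (a N) + 6 * real r * \<epsilon>'"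
    using surgery[OF A(3) A(6) C(3) p1 j(1,2) n(2,3) A(11,12) C(6) \<eta>(2) less_imp_le[OF \<eta>(1)] less_imp_le[OF \<epsilon>'(1)] close]
    by blast
  have "peierls_rat S (\<rho>' N) (\<xi> N) \<le> action S (p' N) z - action S (p' N) (c N)"
    by (rule peierls_rat_le[OF C(1,3) z(1)]) (simp add: z(2) A(7))
  also have "\<dots> \<le> peierls_rat S (\<rho> N) (\<xi> N) + \<epsilon>" using z(3) A(10)[of N] \<epsilon>'(2) by simp
  finally show False using seq(5)[of N] by simp
qed

lemma peierls_rat_uniformly_cauchy:
  assumes "\<omega> \<notin> \<rat>" "\<epsilon> > 0"
  shows "\<exists>\<delta>>0. \<forall>\<rho> \<rho>' \<xi>. \<bar>real_of_rat \<rho> - \<omega>\<bar> < \<delta> \<longrightarrow> \<bar>real_of_rat \<rho>' - \<omega>\<bar> < \<delta> \<longrightarrow>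
     \<bar>peierls_rat S \<rho> \<xi> - peierls_rat S \<rho>' \<xi>\<bar> \<le> \<epsilon>"
proof -
  obtain \<delta> where \<delta>: "\<delta> > 0" "\<And>\<rho> \<rho>' \<xi>. \<bar>real_of_rat \<rho> - \<omega>\<bar> < \<delta> \<Longrightarrow> \<bar>real_of_rat \<rho>' - \<omega>\<bar> < \<delta> \<Longrightarrow>
     peierls_rat S \<rho>' \<xi> \<le> peierls_rat S \<rho> \<xi> + \<epsilon>"
    using peierls_rat_upper[OF assms] by blast
  have "\<bar>peierls_rat S \<rho> \<xi> - peierls_rat S \<rho>' \<xi>\<bar> \<le> \<epsilon>"
    if "\<bar>real_of_rat \<rho> - \<omega>\<bar> < \<delta>" "\<bar>real_of_rat \<rho>' - \<omega>\<bar> < \<delta>" for \<rho> \<rho>' \<xi>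
    using \<delta>(2)[OF that, of \<xi>] \<delta>(2)[OF that(2,1), of \<xi>] by linarith
  then show ?thesis using \<delta>(1) by blast
qed

end

section \<open>Continuity at irrational rotation numbers\<close>

lemma ex_rat_near:
  fixes \<omega> :: real
  assumes "\<delta> > 0"
  shows "\<exists>\<rho>. \<bar>real_of_rat \<rho> - \<omega>\<bar> < \<delta>"
proof -
  obtain \<rho> where "\<omega> < real_of_rat \<rho>" "real_of_rat \<rho> < \<omega> + \<delta>"
    using of_rat_dense[of \<omega> "\<omega> + \<delta>"] assms by auto
  then show ?thesis by (intro exI[of _ \<rho>]) simp
qed

text \<open>Density of the rationals makes the filter proper, so that limits along it are
  unique.\<close>

lemma filtercomap_of_rat_nhds_neq_bot: "filtercomap real_of_rat (nhds \<omega>) \<noteq> bot"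
proof (rule filtercomap_neq_bot)
  fix P assume "eventually P (nhds \<omega>)"
  then obtain d where "d > 0" "\<And>x. \<bar>x - \<omega>\<bar> < d \<Longrightarrow> P x"
    unfolding eventually_nhds_metric dist_real_def by blast
  then show "\<exists>\<rho>. P (real_of_rat \<rho>)" using ex_rat_near by blast
qed

lemma eventually_rat_near:
  assumes "\<delta> > 0" "\<And>\<rho>. \<bar>real_of_rat \<rho> - \<omega>\<bar> < \<delta> \<Longrightarrow> P \<rho>"
  shows "eventually P (filtercomap real_of_rat (nhds \<omega>))"
proof -
  have "eventually (\<lambda>x. \<bar>x - \<omega>\<bar> < \<delta>) (nhds \<omega>)"
    unfolding eventually_nhds_metric dist_real_def using assms(1) by blast
  then show ?thesis unfolding eventually_filtercomap using assms(2) by blast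
qed

text \<open>\<open>Lim\<close> is a definite description and has the intended value only if a limit
  exists. A limit is found along one rational sequence, and the Cauchy property extends it to the
  whole filter.\<close>

lemma rational_cauchy_tendsto_Lim:
  fixes f :: "rat \<Rightarrow> real"
  assumes "\<And>\<epsilon>. \<epsilon> > 0 \<Longrightarrow> \<exists>\<delta>>0. \<forall>\<rho> \<rho>'. \<bar>real_of_rat \<rho> - \<omega>\<bar> < \<delta> \<longrightarrow> \<bar>real_of_rat \<rho>' - \<omega>\<bar> < \<delta> \<longrightarrow> \<bar>f \<rho> - f \<rho>'\<bar> \<le> \<epsilon>"
  shows "(f \<longlongrightarrow> Lim (filtercomap real_of_rat (nhds \<omega>)) f) (filtercomap real_of_rat (nhds \<omega>))"
proof -
  have "\<exists>\<rho>. \<bar>real_of_rat \<rho> - \<omega>\<bar> < inverse (real (Suc n))" for n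
    by (rule ex_rat_near) simp
  then obtain \<rho> where \<rho>: "\<And>n. \<bar>real_of_rat (\<rho> n) - \<omega>\<bar> < inverse (real (Suc n))" by metis
  have near: "\<exists>N. \<forall>n\<ge>N. \<bar>real_of_rat (\<rho> n) - \<omega>\<bar> < \<delta>" if pos: "\<delta> > 0" for \<delta>
  proof -
    obtain N where N: "\<And>n. n \<ge> N \<Longrightarrow> inverse (real (Suc n)) < \<delta>"
      using order_tendstoD(2)[OF LIMSEQ_inverse_real_of_nat pos] unfolding eventually_sequentially by blast
    then show ?thesis using \<rho> by (meson order_less_trans)
  qed
  have "Cauchy (\<lambda>n. f (\<rho> n))"
  proof (rule metric_CauchyI)
    fix e :: real assume "e > 0"
    then obtain \<delta> where \<delta>: "\<delta> > 0"
      "\<And>\<rho> \<rho>'. \<bar>real_of_rat \<rho> - \<omega>\<bar> < \<delta> \<Longrightarrow> \<bar>real_of_rat \<rho>' - \<omega>\<bar> < \<delta> \<Longrightarrow> \<bar>f \<rho> - f \<rho>'\<bar> \<le> e / 2"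
      using assms[of "e / 2"] by auto
    obtain N where "\<And>n. n \<ge> N \<Longrightarrow> \<bar>real_of_rat (\<rho> n) - \<omega>\<bar> < \<delta>" using near[OF \<delta>(1)] by blast
    then have "dist (f (\<rho> m)) (f (\<rho> n)) < e" if "m \<ge> N" "n \<ge> N" for m n
      using \<delta>(2)[of "\<rho> m" "\<rho> n"] that \<open>e > 0\<close> by (fastforce simp: dist_real_def)
    then show "\<exists>M. \<forall>m\<ge>M. \<forall>n\<ge>M. dist (f (\<rho> m)) (f (\<rho> n)) < e" by blast
  qed
  then obtain L where L: "(\<lambda>n. f (\<rho> n)) \<longlonglongrightarrow> L"
    using Cauchy_convergent_iff convergent_def by blast
  have "(f \<longlongrightarrow> L) (filtercomap real_of_rat (nhds \<omega>))"
  proof (rule tendstoI)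
    fix e :: real assume e: "e > 0"
    then obtain \<delta> where \<delta>: "\<delta> > 0"
      "\<And>\<rho> \<rho>'. \<bar>real_of_rat \<rho> - \<omega>\<bar> < \<delta> \<Longrightarrow> \<bar>real_of_rat \<rho>' - \<omega>\<bar> < \<delta> \<Longrightarrow> \<bar>f \<rho> - f \<rho>'\<bar> \<le> e / 2"
      using assms[of "e / 2"] by auto
    obtain N where N: "\<And>n. n \<ge> N \<Longrightarrow> \<bar>real_of_rat (\<rho> n) - \<omega>\<bar> < \<delta>" using near[OF \<delta>(1)] by blast
    obtain M where M: "\<And>n. n \<ge> M \<Longrightarrow> \<bar>f (\<rho> n) - L\<bar> < e / 2"
      using LIMSEQ_D[OF L, of "e / 2"] e by auto
    define n where "n = max M N"
    show "\<forall>\<^sub>F \<rho> in filtercomap real_of_rat (nhds \<omega>). dist (f \<rho>) L < e"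
    proof (rule eventually_rat_near[OF \<delta>(1)])
      fix \<sigma> assume "\<bar>real_of_rat \<sigma> - \<omega>\<bar> < \<delta>"
      then have "\<bar>f \<sigma> - f (\<rho> n)\<bar> \<le> e / 2" using \<delta>(2) N[of n] by (simp add: n_def)
      moreover have "\<bar>f (\<rho> n) - L\<bar> < e / 2" using M by (simp add: n_def)
      ultimately show "dist (f \<sigma>) L < e" unfolding dist_real_def by linarith
    qed
  qed
  then show ?thesis using tendsto_Lim[OF filtercomap_of_rat_nhds_neq_bot] by metis
qed

section \<open>The barrier at irrational numbers\<close>

context local_potential
begin

text \<open>The Cauchy estimate is passed to the limit in one of its two rationals. Its
  \<open>\<delta>\<close> is independent of \<open>\<xi>\<close>, and so is the result.\<close>

lemma peierls_irrational_near:
  assumes \<omega>: "\<omega> \<notin> \<rat>" and "\<epsilon> > 0"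
  shows "\<exists>\<delta>>0. \<forall>\<rho> \<xi>. \<bar>real_of_rat \<rho> - \<omega>\<bar> < \<delta> \<longrightarrow> \<bar>peierls S \<omega> \<xi> - peierls_rat S \<rho> \<xi>\<bar> \<le> \<epsilon>"
proof -
  let ?F = "filtercomap real_of_rat (nhds \<omega>)"
  have lim: "((\<lambda>\<rho>. peierls_rat S \<rho> \<xi>) \<longlongrightarrow> peierls S \<omega> \<xi>) ?F" for \<xi>
  proof -
    have "\<exists>\<delta>>0. \<forall>\<rho> \<rho>'. \<bar>real_of_rat \<rho> - \<omega>\<bar> < \<delta> \<longrightarrow> \<bar>real_of_rat \<rho>' - \<omega>\<bar> < \<delta> \<longrightarrow>
        \<bar>peierls_rat S \<rho> \<xi> - peierls_rat S \<rho>' \<xi>\<bar> \<le> e" if "e > 0" for e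
      using peierls_rat_uniformly_cauchy[OF \<omega> that] by blast
    from rational_cauchy_tendsto_Lim[OF this] show ?thesis using \<omega> by (simp add: peierls_def)
  qed
  obtain \<delta> where \<delta>: "\<delta> > 0" "\<And>\<rho> \<rho>' \<xi>. \<bar>real_of_rat \<rho> - \<omega>\<bar> < \<delta> \<Longrightarrow> \<bar>real_of_rat \<rho>' - \<omega>\<bar> < \<delta> \<Longrightarrow>
     \<bar>peierls_rat S \<rho> \<xi> - peierls_rat S \<rho>' \<xi>\<bar> \<le> \<epsilon>"
    using peierls_rat_uniformly_cauchy[OF assms] by blast
  have "\<bar>peierls S \<omega> \<xi> - peierls_rat S \<rho> \<xi>\<bar> \<le> \<epsilon>" if "\<bar>real_of_rat \<rho> - \<omega>\<bar> < \<delta>" for \<rho> \<xi>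
  proof (rule tendsto_upperbound[OF _ _ filtercomap_of_rat_nhds_neq_bot])
    show "((\<lambda>\<rho>'. \<bar>peierls_rat S \<rho>' \<xi> - peierls_rat S \<rho> \<xi>\<bar>) \<longlongrightarrow> \<bar>peierls S \<omega> \<xi> - peierls_rat S \<rho> \<xi>\<bar>) ?F"
      by (intro tendsto_intros lim)
    show "\<forall>\<^sub>F \<rho>' in ?F. \<bar>peierls_rat S \<rho>' \<xi> - peierls_rat S \<rho> \<xi>\<bar> \<le> \<epsilon>"
      by (rule eventually_rat_near[OF \<delta>(1)]) (rule \<delta>(2)[OF _ that])
  qed
  then show ?thesis using \<delta>(1) by blast
qed

end

theorem corollary5p3:
  fixes r :: nat and S :: "real ^ 'n::{finite,linorder} \<Rightarrow> real"
  assumes "r \<ge> 1" and "CARD('n) = r + 1"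
    and "periodicity S" and "monotonicity S" and "coercivity S"
  shows "\<forall>\<omega>. \<omega> \<notin> \<rat> \<longrightarrow> (\<forall>\<epsilon>>0. \<exists>\<delta>>0. \<forall>\<Omega> \<xi>. \<bar>\<Omega> - \<omega>\<bar> < \<delta> \<longrightarrow>
           \<bar>peierls S \<omega> \<xi> - peierls S \<Omega> \<xi>\<bar> < \<epsilon>)"
proof (intro allI impI)
  interpret local_potential S r by unfold_locales (use assms in auto)
  fix \<omega> \<epsilon> :: real
  assume \<omega>: "\<omega> \<notin> \<rat>" and \<epsilon>: "\<epsilon> > 0"
  then have "\<epsilon> / 3 > 0" by simp
  then obtain \<delta> where \<delta>: "\<delta> > 0"
    "\<And>\<rho> \<xi>. \<bar>real_of_rat \<rho> - \<omega>\<bar> < \<delta> \<Longrightarrow> \<bar>peierls S \<omega> \<xi> - peierls_rat S \<rho> \<xi>\<bar> \<le> \<epsilon> / 3"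
    using peierls_irrational_near[OF \<omega>] by blast
  have "\<bar>peierls S \<omega> \<xi> - peierls S \<Omega> \<xi>\<bar> < \<epsilon>" if \<Omega>: "\<bar>\<Omega> - \<omega>\<bar> < \<delta>" for \<Omega> \<xi>
  proof (cases "\<Omega> \<in> \<rat>")
    case True
    then obtain \<rho> where \<rho>: "\<Omega> = real_of_rat \<rho>" by (auto elim: Rats_cases)
    then have "peierls S \<Omega> \<xi> = peierls_rat S \<rho> \<xi>" by (simp add: peierls_def)
    then show ?thesis using \<delta>(2)[of \<rho> \<xi>] \<Omega> \<rho> \<epsilon> by simp
  next
    case False
    obtain \<delta>' where \<delta>': "\<delta>' > 0"
      "\<And>\<rho> \<xi>. \<bar>real_of_rat \<rho> - \<Omega>\<bar> < \<delta>' \<Longrightarrow> \<bar>peierls S \<Omega> \<xi> - peierls_rat S \<rho> \<xi>\<bar> \<le> \<epsilon> / 3"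
      using peierls_irrational_near[OF False \<open>\<epsilon> / 3 > 0\<close>] by blast
    \<comment> \<open>A rational close enough to \<open>\<Omega>\<close> still lies within
      \<open>\<delta>\<close> of \<open>\<omega>\<close> and mediates between the two irrational
      barriers; the two errors of \<open>\<epsilon> / 3\<close> leave the inequality strict.\<close>
    obtain \<rho> where "\<bar>real_of_rat \<rho> - \<Omega>\<bar> < min \<delta>' (\<delta> - \<bar>\<Omega> - \<omega>\<bar>)"
      using ex_rat_near[of "min \<delta>' (\<delta> - \<bar>\<Omega> - \<omega>\<bar>)" \<Omega>] \<delta>'(1) \<Omega> by auto
    then have "\<bar>real_of_rat \<rho> - \<Omega>\<bar> < \<delta>'" "\<bar>real_of_rat \<rho> - \<omega>\<bar> < \<delta>" by linarith+
    then show ?thesis using \<delta>(2)[of \<rho> \<xi>] \<delta>'(2)[of \<rho> \<xi>] \<epsilon> by linarith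
  qed
  then show "\<exists>\<delta>>0. \<forall>\<Omega> \<xi>. \<bar>\<Omega> - \<omega>\<bar> < \<delta> \<longrightarrow> \<bar>peierls S \<omega> \<xi> - peierls S \<Omega> \<xi>\<bar> < \<epsilon>"
    using \<delta>(1) by blast
qed

end
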